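(* Let $k$ be a field of characteristic $p>0$, $R$ a finitely generated $\mathbb{N}$-graded $k$-algebra, $I\subseteq R$ a homogeneous ideal of finite co-length, and $M$ a finitely generated $\mathbb{Z}$-graded $R$-module. Then the Hilbert-Kunz multiplicity of the triple $(M,R,I)$ is $F(M,R,I)(0)$, the value at $0$ of the Frobenius-Poincaré function of $(M,R,I)$.
   Context: A finitely generated $\mathbb{N}$-graded $k$-algebra is an $\mathbb{N}$-graded commutative ring with degree zero piece $k$, finitely generated over $k$. $I$ has finite co-length if $R/I$ has finite length. $I^{[p^n]}$ is the ideal generated by $p^n$-th powers of elements of $I$; $(\cdot)_j$ is the degree $j$ piece; $\lambda$ is length over $k$ and $\lambda_R$ is length over $R$; $i$ is a fixed square root of $-1$. The Hilbert-Kunz multiplicity of $(M,R,I)$ is $\lim_{n\to\infty}\left(\frac{1}{p^n}\right)^{\dim(M)}\lambda_R\left(\frac{M}{I^{[p^n]}M}\right)$. The Frobenius-Poincaré function is the entire function $$F(M,R,I)(y)=\lim_{n\to\infty}\left(\frac{1}{p^n}\right)^{\dim M}\sum_{j\in\mathbb{Z}}\lambda\left(\left(\frac{M}{I^{[p^n]}M}\right)_j\right)e^{-iyj/p^n},$$ where the limit exists for all $y\in\mathbb{C}$. *)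

theory Defs
  imports "HOL-Algebra.Module" "HOL-Algebra.QuotRing" "HOL-Algebra.Generated_Rings"
    "HOL-Analysis.Infinite_Sum"
begin

section \<open>Length, quotients and dimension of modules\<close>

definition module_length :: "('a, 'r) ring_scheme \<Rightarrow> ('a, 'b, 'm) module_scheme \<Rightarrow> enat" where
  "module_length R M =
     Sup {enat n | n. \<exists>C. (\<forall>i\<le>n. submodule (C i) R M) \<and> (\<forall>i<n. C i \<subset> C (Suc i))}"

definition module_span ::
  "('a, 'r) ring_scheme \<Rightarrow> ('a, 'b, 'm) module_scheme \<Rightarrow> 'b set \<Rightarrow> 'b set" where
  "module_span R M S = \<Inter>{N. submodule N R M \<and> S \<subseteq> N}"

definition fin_gen_module ::
  "('a, 'r) ring_scheme \<Rightarrow> ('a, 'b, 'm) module_scheme \<Rightarrow> bool" where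
  "fin_gen_module R M \<longleftrightarrow>
     (\<exists>S. finite S \<and> S \<subseteq> carrier M \<and> module_span R M S = carrier M)"

text \<open>The record type of modules extends that of rings; the fields \<open>mult\<close> and \<open>one\<close> play no role
  for modules.\<close>

definition quotient_module ::
  "('a, 'b, 'm) module_scheme \<Rightarrow> 'b set \<Rightarrow> ('a, 'b set) module" where
  "quotient_module M N =
     \<lparr>carrier = a_rcosets\<^bsub>M\<^esub> N, monoid.mult = undefined, one = undefined, zero = N, add = set_add M,
      smult = (\<lambda>r A. \<Union>x\<in>A. N +>\<^bsub>M\<^esub> (r \<odot>\<^bsub>M\<^esub> x))\<rparr>"

definition regular_module :: "('a, 'r) ring_scheme \<Rightarrow> ('a, 'a) module" where
  "regular_module R =
     \<lparr>carrier = carrier R, monoid.mult = monoid.mult R, one = one R, zero = zero R, add = add R,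
      smult = monoid.mult R\<rparr>"

definition finite_colength :: "('a, 'r) ring_scheme \<Rightarrow> 'a set \<Rightarrow> bool" where
  "finite_colength R I \<longleftrightarrow> module_length R (quotient_module (regular_module R) I) \<noteq> \<infinity>"

definition krull_dim :: "('a, 'r) ring_scheme \<Rightarrow> enat" where
  "krull_dim R =
     Sup {enat n | n. \<exists>P. (\<forall>i\<le>n. primeideal (P i) R) \<and> (\<forall>i<n. P i \<subset> P (Suc i))}"

definition annihilator :: "('a, 'r) ring_scheme \<Rightarrow> ('a, 'b, 'm) module_scheme \<Rightarrow> 'a set" where
  "annihilator R M = {r \<in> carrier R. \<forall>m \<in> carrier M. r \<odot>\<^bsub>M\<^esub> m = \<zero>\<^bsub>M\<^esub>}"

text \<open>The zero module gets dimension \<open>Sup {} = 0\<close>. The dimension only occurs as the exponent of a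
  normalizing factor in front of lengths, which all vanish in that case.\<close>

definition module_dim :: "('a, 'r) ring_scheme \<Rightarrow> ('a, 'b, 'm) module_scheme \<Rightarrow> enat" where
  "module_dim R M = krull_dim (R Quot annihilator R M)"


section \<open>Graded algebras and graded modules\<close>

definition has_characteristic :: "('a, 'r) ring_scheme \<Rightarrow> nat \<Rightarrow> bool" where
  "has_characteristic R p \<longleftrightarrow> (\<forall>n::nat. [n] \<cdot>\<^bsub>R\<^esub> \<one>\<^bsub>R\<^esub> = \<zero>\<^bsub>R\<^esub> \<longleftrightarrow> p dvd n)"

definition internal_direct_sum :: "('a, 'r) ring_scheme \<Rightarrow> ('i \<Rightarrow> 'a set) \<Rightarrow> bool" where
  "internal_direct_sum G A \<longleftrightarrow>
     (\<forall>i. subgroup (A i) (add_monoid G)) \<and>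
     (\<forall>x \<in> carrier G. \<exists>!f. (\<forall>i. f i \<in> A i) \<and> finite {i. f i \<noteq> \<zero>\<^bsub>G\<^esub>} \<and>
        x = (\<Oplus>\<^bsub>G\<^esub>i\<in>{i. f i \<noteq> \<zero>\<^bsub>G\<^esub>}. f i))"

text \<open>The last condition says that the structure map identifies \<open>K\<close> with the degree zero piece.
  It makes each \<open>Rd n\<close> a \<open>K\<close>-subspace.\<close>

locale nat_graded_algebra = algebra K R
  for K :: "('k, 'c) ring_scheme" (structure) and R :: "('k, 'r, 'd) module_scheme" (structure) +
  fixes Rd :: "nat \<Rightarrow> 'r set"
  assumes direct_sum: "internal_direct_sum R Rd"
    and mult_degree: "\<lbrakk>x \<in> Rd m; y \<in> Rd n\<rbrakk> \<Longrightarrow> x \<otimes>\<^bsub>R\<^esub> y \<in> Rd (m + n)"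
    and degree_zero: "bij_betw (\<lambda>c. c \<odot>\<^bsub>R\<^esub> \<one>\<^bsub>R\<^esub>) (carrier K) (Rd 0)"

definition fin_gen_algebra ::
  "('k, 'c) ring_scheme \<Rightarrow> ('k, 'r, 'd) module_scheme \<Rightarrow> bool" where
  "fin_gen_algebra K R \<longleftrightarrow>
     (\<exists>S. finite S \<and> S \<subseteq> carrier R \<and>
        generate_ring R ((\<lambda>c. c \<odot>\<^bsub>R\<^esub> \<one>\<^bsub>R\<^esub>) ` carrier K \<union> S) = carrier R)"

locale int_graded_module = module R M
  for R :: "('r, 'd) ring_scheme" (structure) and M :: "('r, 'm, 'e) module_scheme" (structure) +
  fixes Rd :: "nat \<Rightarrow> 'r set" and Md :: "int \<Rightarrow> 'm set"
  assumes direct_sum: "internal_direct_sum M Md"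
    and smult_degree: "\<lbrakk>x \<in> Rd n; m \<in> Md j\<rbrakk> \<Longrightarrow> x \<odot>\<^bsub>M\<^esub> m \<in> Md (int n + j)"

definition homogeneous_ideal ::
  "('r, 'd) ring_scheme \<Rightarrow> (nat \<Rightarrow> 'r set) \<Rightarrow> 'r set \<Rightarrow> bool" where
  "homogeneous_ideal R Rd I \<longleftrightarrow> (\<exists>H \<subseteq> (\<Union>n. Rd n). I = Idl\<^bsub>R\<^esub> H)"


section \<open>Hilbert-Kunz multiplicity and Frobenius-Poincare function\<close>

definition bracket_power :: "('r, 'd) ring_scheme \<Rightarrow> 'r set \<Rightarrow> nat \<Rightarrow> 'r set" where
  "bracket_power R I q = Idl\<^bsub>R\<^esub> {x [^]\<^bsub>R\<^esub> q | x. x \<in> I}"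

definition ideal_smult ::
  "('r, 'd) ring_scheme \<Rightarrow> ('r, 'm, 'e) module_scheme \<Rightarrow> 'r set \<Rightarrow> 'm set" where
  "ideal_smult R M J = module_span R M {a \<odot>\<^bsub>M\<^esub> m | a m. a \<in> J \<and> m \<in> carrier M}"

text \<open>For a submodule \<open>N\<close> of a graded module \<open>M\<close>, the degree \<open>j\<close> piece of \<open>M / N\<close> is the image of
  the degree \<open>j\<close> piece of \<open>M\<close>. Scalars are restricted along the structure map \<open>K \<rightarrow> R\<close>.\<close>

definition quotient_piece ::
  "('k, 'r, 'd) module_scheme \<Rightarrow> ('r, 'm, 'e) module_scheme \<Rightarrow> (int \<Rightarrow> 'm set) \<Rightarrow> 'm set \<Rightarrow> int
     \<Rightarrow> ('k, 'm set) module" where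
  "quotient_piece R M Md N j =
     \<lparr>carrier = (\<lambda>m. N +>\<^bsub>M\<^esub> m) ` Md j, monoid.mult = undefined, one = undefined,
      zero = zero (quotient_module M N), add = add (quotient_module M N),
      smult = (\<lambda>c A. (c \<odot>\<^bsub>R\<^esub> \<one>\<^bsub>R\<^esub>) \<odot>\<^bsub>quotient_module M N\<^esub> A)\<rparr>"

text \<open>All lengths below are finite for graded \<open>R\<close> and \<open>M\<close> as above and homogeneous \<open>I\<close> of finite
  colength. The Hilbert-Kunz multiplicity is the limit of a sequence of real numbers; the limit is
  taken in the complex numbers, where the Frobenius-Poincare function has its values.\<close>

definition hilbert_kunz_multiplicity ::
  "nat \<Rightarrow> ('r, 'd) ring_scheme \<Rightarrow> ('r, 'm, 'e) module_scheme \<Rightarrow> 'r set \<Rightarrow> complex" where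
  "hilbert_kunz_multiplicity p R M I =
     lim (\<lambda>n. (1 / of_nat p ^ n) ^ the_enat (module_dim R M) *
       of_nat (the_enat (module_length R
         (quotient_module M (ideal_smult R M (bracket_power R I (p ^ n)))))))"

text \<open>The sum over all integers \<open>j\<close> has only finitely many nonzero terms.\<close>

definition frobenius_poincare ::
  "nat \<Rightarrow> ('k, 'c) ring_scheme \<Rightarrow> ('k, 'r, 'd) module_scheme \<Rightarrow> ('r, 'm, 'e) module_scheme
     \<Rightarrow> (int \<Rightarrow> 'm set) \<Rightarrow> 'r set \<Rightarrow> complex \<Rightarrow> complex" where
  "frobenius_poincare p K R M Md I y =
     lim (\<lambda>n. (1 / of_nat p ^ n) ^ the_enat (module_dim R M) *
       (\<Sum>\<^sub>\<infinity>j\<in>UNIV. of_nat (the_enat (module_length K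
           (quotient_piece R M Md (ideal_smult R M (bracket_power R I (p ^ n))) j))) *
         exp (- \<i> * y * of_int j / of_nat p ^ n)))"

end

theory Submission
  imports Defs
begin

text \<open>
  Both sides are limits of sequences with the same normalizing factor, and at \<open>y = 0\<close> all the
  exponentials equal \<open>1\<close>. So the claim is that, for \<open>q = p ^ n\<close> and \<open>N = I\<^sup>[\<^sup>q\<^sup>] M\<close>, the length of
  \<open>M / N\<close> over \<open>R\<close> is the sum over \<open>j\<close> of the lengths of \<open>(M / N)\<^sub>j\<close> over \<open>K\<close>: the
  two sequences then agree term by term.

  The equality comes from the filtration of \<open>M\<close> by the submodules \<open>L\<^sub>j\<close> of all elements whose
  components in degrees below \<open>j\<close> lie in \<open>N\<close>. Elements of positive degree of \<open>R\<close> map \<open>L\<^sub>j\<close> into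
  \<open>L\<^sub>j\<^sub>+\<^sub>1\<close>, so \<open>R\<close> acts on \<open>L\<^sub>j / L\<^sub>j\<^sub>+\<^sub>1\<close>, which is \<open>(M / N)\<^sub>j\<close>, through \<open>R\<^sub>0 = K\<close>, and both notions of
  length agree there (\<open>graded_piece_length\<close>). Length is additive, by the modular law for
  submodules (\<open>relative_length_additive\<close>), so the lengths of the pieces add up to the length of
  \<open>M / N\<close>, provided that the filtration reaches \<open>M\<close> and \<open>N\<close> after finitely many steps and the
  lengths are finite. Finiteness also makes the passage from extended naturals
  to complex numbers additive.

  Three facts complete the argument. The submodule \<open>N\<close> is homogeneous, because the Frobenius power
  \<open>x \<mapsto> x\<^sup>q\<close> is additive and so \<open>I\<^sup>[\<^sup>q\<^sup>]\<close> is generated by the \<open>q\<close>-th powers of homogeneous generators of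
  \<open>I\<close> (\<open>bracket_power_homogeneous\<close>). The ideal \<open>I\<close> contains all pieces of \<open>R\<close> of high degree, because
  otherwise the filtration of \<open>R / I\<close> by degree would contain arbitrarily long chains
  (\<open>high_degrees_in_ideal\<close>). Hence a power of each homogeneous algebra generator of positive degree
  kills \<open>M / N\<close>, so that \<open>M / N\<close> is spanned over \<open>K\<close> by finitely many monomials applied to the
  generators of \<open>M\<close> and has finite length (\<open>finite_length_if_nilpotent_generators\<close>).
\<close>


section \<open>Lengths of chains of sets\<close>

text \<open>Strict chains of length \<open>n\<close> in a family of sets, recorded by their top element only: all that
  the arguments below do to a chain is to extend it or to replace its top.\<close>
fun chain_to :: "'a set set \<Rightarrow> nat \<Rightarrow> 'a set \<Rightarrow> bool" where
  "chain_to P 0 X \<longleftrightarrow> X \<in> P"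
| "chain_to P (Suc n) X \<longleftrightarrow> X \<in> P \<and> (\<exists>Y. Y \<subset> X \<and> chain_to P n Y)"

definition chain_height :: "'a set set \<Rightarrow> enat" where
  "chain_height P = Sup {enat n | n. \<exists>X. chain_to P n X}"

lemma chain_to_mem: "chain_to P n X \<Longrightarrow> X \<in> P"
  by (cases n) auto

lemma chain_to_iff_sequence:
  "chain_to P n X \<longleftrightarrow> (\<exists>C. C n = X \<and> (\<forall>i\<le>n. C i \<in> P) \<and> (\<forall>i<n. C i \<subset> C (Suc i)))"
proof (induction n arbitrary: X)
  case 0
  show ?case by auto
next
  case (Suc n)
  show ?case
  proof
    assume "chain_to P (Suc n) X"
    then obtain Y where X: "X \<in> P" "Y \<subset> X" and "chain_to P n Y" by auto
    then obtain C where C: "C n = Y" "\<forall>i\<le>n. C i \<in> P" "\<forall>i<n. C i \<subset> C (Suc i)"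
      unfolding Suc by blast
    let ?C = "C(Suc n := X)"
    have "?C (Suc n) = X" "\<forall>i\<le>Suc n. ?C i \<in> P" using C X by auto
    moreover have "\<forall>i<Suc n. ?C i \<subset> ?C (Suc i)" using C X by (auto simp: less_Suc_eq)
    ultimately show "\<exists>C. C (Suc n) = X \<and> (\<forall>i\<le>Suc n. C i \<in> P) \<and> (\<forall>i<Suc n. C i \<subset> C (Suc i))"
      by blast
  next
    assume "\<exists>C. C (Suc n) = X \<and> (\<forall>i\<le>Suc n. C i \<in> P) \<and> (\<forall>i<Suc n. C i \<subset> C (Suc i))"
    then obtain C where C: "C (Suc n) = X" "\<forall>i\<le>Suc n. C i \<in> P" "\<forall>i<Suc n. C i \<subset> C (Suc i)"
      by blast
    have "chain_to P n (C n)" unfolding Suc by (rule exI[of _ C]) (use C in auto)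
    moreover have "C n \<subset> X" "X \<in> P" using C by auto
    ultimately show "chain_to P (Suc n) X" by auto
  qed
qed

lemma module_length_eq_chain_height: "module_length R M = chain_height {H. submodule H R M}"
  unfolding module_length_def chain_height_def chain_to_iff_sequence by simp

lemma chain_height_upper: "chain_to P n X \<Longrightarrow> enat n \<le> chain_height P"
  unfolding chain_height_def by (auto intro: Sup_upper)

lemma chain_height_least:
  assumes "\<And>n X. chain_to P n X \<Longrightarrow> enat n \<le> b"
  shows "chain_height P \<le> b"
  unfolding chain_height_def by (rule Sup_least) (use assms in auto)

lemma chain_to_shorten: "chain_to P n X \<Longrightarrow> m \<le> n \<Longrightarrow> \<exists>Y. chain_to P m Y"
proof (induction n arbitrary: X)
  case (Suc n)
  then show ?case by (cases "m = Suc n") auto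
qed auto

text \<open>A supremum of natural numbers in \<^typ>\<open>enat\<close> need not be attained, but every finite lower bound
  for it is the length of a chain.\<close>
lemma chain_height_attained:
  assumes "P \<noteq> {}" and "enat n \<le> chain_height P"
  shows "\<exists>X. chain_to P n X"
proof (cases n)
  case 0
  then show ?thesis using assms by auto
next
  case (Suc k)
  have "\<exists>m X. n \<le> m \<and> chain_to P m X"
  proof (rule ccontr)
    assume *: "\<nexists>m X. n \<le> m \<and> chain_to P m X"
    have "chain_height P \<le> enat k"
      by (rule chain_height_least) (use * Suc in \<open>force simp: not_less_eq_eq\<close>)
    then show False using assms Suc by (metis enat_ord_simps(1) not_less_eq_eq order.trans order_refl)
  qed
  then show ?thesis using chain_to_shorten by blast
qed

lemma chain_to_map:
  assumes "\<And>X. X \<in> P \<Longrightarrow> f X \<in> Q"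
    and "\<And>X Y. X \<in> P \<Longrightarrow> Y \<in> P \<Longrightarrow> X \<subset> Y \<Longrightarrow> f X \<subset> f Y"
    and "chain_to P n X"
  shows "chain_to Q n (f X)"
  using assms(3)
proof (induction n arbitrary: X)
  case 0
  then show ?case using assms(1) by simp
next
  case (Suc n)
  then obtain Y where "Y \<subset> X" "chain_to P n Y" "X \<in> P" by auto
  moreover from this have "f Y \<subset> f X" by (intro assms chain_to_mem[of P n Y])
  ultimately show ?case using Suc.IH[of Y] assms(1)[of X] by auto
qed

lemma chain_height_le_by_map:
  fixes f :: "'a set \<Rightarrow> 'b set"
  assumes "\<And>X. X \<in> P \<Longrightarrow> f X \<in> Q"
    and "\<And>X Y. X \<in> P \<Longrightarrow> Y \<in> P \<Longrightarrow> X \<subset> Y \<Longrightarrow> f X \<subset> f Y"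
  shows "chain_height P \<le> chain_height Q"
proof (rule chain_height_least)
  fix n X
  assume "chain_to P n X"
  with assms have "chain_to Q n (f X)" by (rule chain_to_map)
  then show "enat n \<le> chain_height Q" by (rule chain_height_upper)
qed

lemma chain_height_mono:
  assumes "P \<subseteq> Q"
  shows "chain_height P \<le> chain_height Q"
  using assms by (intro chain_height_le_by_map[where f = id]) auto

lemma chain_height_eq_by_maps:
  assumes "\<And>X. X \<in> P \<Longrightarrow> f X \<in> Q"
    and "\<And>X Y. X \<in> P \<Longrightarrow> Y \<in> P \<Longrightarrow> X \<subset> Y \<Longrightarrow> f X \<subset> f Y"
    and "\<And>X. X \<in> Q \<Longrightarrow> g X \<in> P"
    and "\<And>X Y. X \<in> Q \<Longrightarrow> Y \<in> Q \<Longrightarrow> X \<subset> Y \<Longrightarrow> g X \<subset> g Y"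
  shows "chain_height P = chain_height Q"
proof (rule order_antisym)
  show "chain_height P \<le> chain_height Q" by (rule chain_height_le_by_map[OF assms(1,2)])
  show "chain_height Q \<le> chain_height P" by (rule chain_height_le_by_map[OF assms(3,4)])
qed

lemma chain_to_raise:
  assumes "chain_to P n X" "X \<subseteq> Y" "Y \<in> P"
  shows "chain_to P n Y"
proof (cases n)
  case (Suc k)
  with assms obtain Z where "Z \<subset> X" "chain_to P k Z" by auto
  moreover from this have "Z \<subset> Y" using assms by simp
  ultimately show ?thesis using Suc assms by auto
qed (use assms in simp)

(* As a rewrite rule the recursive equation sends the automatic methods into an endless search for
   the next member of the chain. *)
declare chain_to.simps(2) [simp del]


section \<open>Subgroups of a module that are stable under a set of scalars\<close>

text \<open>For \<open>S = carrier R\<close> these are the submodules; for \<open>S\<close> the degree zero piece of a graded ring they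
  are the vector subspaces. Treating both in one lattice makes their lengths comparable.\<close>
definition stable_subgroups :: "('a, 'b, 'm) module_scheme \<Rightarrow> 'a set \<Rightarrow> 'b set set" where
  "stable_subgroups M S = {H. subgroup H (add_monoid M) \<and> (\<forall>a\<in>S. \<forall>x\<in>H. a \<odot>\<^bsub>M\<^esub> x \<in> H)}"

definition stable_between ::
  "('a, 'b, 'm) module_scheme \<Rightarrow> 'a set \<Rightarrow> 'b set \<Rightarrow> 'b set \<Rightarrow> 'b set set" where
  "stable_between M S A B = {H \<in> stable_subgroups M S. A \<subseteq> H \<and> H \<subseteq> B}"

text \<open>The length of \<open>B / A\<close>, without forming the quotient.\<close>
definition relative_length ::
  "('a, 'b, 'm) module_scheme \<Rightarrow> 'a set \<Rightarrow> 'b set \<Rightarrow> 'b set \<Rightarrow> enat" where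
  "relative_length M S A B = chain_height (stable_between M S A B)"

lemma additive_subgroup_iff:
  "subgroup H (add_monoid G) \<longleftrightarrow>
     H \<subseteq> carrier G \<and> \<zero>\<^bsub>G\<^esub> \<in> H \<and> (\<forall>x\<in>H. \<forall>y\<in>H. x \<oplus>\<^bsub>G\<^esub> y \<in> H) \<and> (\<forall>x\<in>H. \<ominus>\<^bsub>G\<^esub> x \<in> H)"
  by (auto simp: subgroup_def a_inv_def)

lemma stable_subgroups_iff:
  "H \<in> stable_subgroups M S \<longleftrightarrow>
     H \<subseteq> carrier M \<and> \<zero>\<^bsub>M\<^esub> \<in> H \<and> (\<forall>x\<in>H. \<forall>y\<in>H. x \<oplus>\<^bsub>M\<^esub> y \<in> H) \<and> (\<forall>x\<in>H. \<ominus>\<^bsub>M\<^esub> x \<in> H) \<and>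
     (\<forall>a\<in>S. \<forall>x\<in>H. a \<odot>\<^bsub>M\<^esub> x \<in> H)"
  by (auto simp: stable_subgroups_def additive_subgroup_iff)

lemma submodule_iff_stable: "submodule H R M \<longleftrightarrow> H \<in> stable_subgroups M (carrier R)"
  by (auto simp: submodule_def submodule_axioms_def stable_subgroups_def)

lemma stable_betweenI:
  "H \<in> stable_subgroups M S \<Longrightarrow> A \<subseteq> H \<Longrightarrow> H \<subseteq> B \<Longrightarrow> H \<in> stable_between M S A B"
  by (simp add: stable_between_def)

lemma stable_betweenD:
  assumes "H \<in> stable_between M S A B"
  shows "H \<in> stable_subgroups M S" "A \<subseteq> H" "H \<subseteq> B"
  using assms by (auto simp: stable_between_def)

lemma stable_Int:
  "X \<in> stable_subgroups M S \<Longrightarrow> Y \<in> stable_subgroups M S \<Longrightarrow> X \<inter> Y \<in> stable_subgroups M S"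
  by (auto simp: stable_subgroups_iff)

lemma stable_subset_scalars: "S \<subseteq> T \<Longrightarrow> stable_subgroups M T \<subseteq> stable_subgroups M S"
  by (auto simp: stable_subgroups_def)

lemma (in abelian_group) add_minus_cancel:
  "x \<in> carrier G \<Longrightarrow> y \<in> carrier G \<Longrightarrow> (x \<ominus> y) \<oplus> y = x"
  "x \<in> carrier G \<Longrightarrow> y \<in> carrier G \<Longrightarrow> (x \<oplus> y) \<ominus> y = x"
  "x \<in> carrier G \<Longrightarrow> y \<in> carrier G \<Longrightarrow> (x \<oplus> y) \<ominus> x = y"
  by (simp_all add: a_minus_def a_assoc l_neg r_neg) (metis a_comm a_inv_closed r_neg2)

context module
begin

lemma stable_minus:
  "H \<in> stable_subgroups M S \<Longrightarrow> x \<in> H \<Longrightarrow> y \<in> H \<Longrightarrow> x \<ominus>\<^bsub>M\<^esub> y \<in> H"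
  by (auto simp: stable_subgroups_iff a_minus_def)

lemma stable_mem_cong:
  assumes H: "H \<in> stable_subgroups M S" and c: "x \<in> carrier M" "y \<in> carrier M"
    and d: "x \<ominus>\<^bsub>M\<^esub> y \<in> H"
  shows "x \<in> H \<longleftrightarrow> y \<in> H"
proof
  assume "y \<in> H"
  then have "(x \<ominus>\<^bsub>M\<^esub> y) \<oplus>\<^bsub>M\<^esub> y \<in> H" using H d by (simp add: stable_subgroups_iff)
  then show "x \<in> H" using M.add_minus_cancel(1)[OF c] by metis
next
  assume "x \<in> H"
  then have "x \<ominus>\<^bsub>M\<^esub> (x \<ominus>\<^bsub>M\<^esub> y) \<in> H" using stable_minus[OF H] d by blast
  moreover have "x \<ominus>\<^bsub>M\<^esub> (x \<ominus>\<^bsub>M\<^esub> y) = y"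
    using c by (simp add: a_minus_def M.minus_add M.r_neg2)
  ultimately show "y \<in> H" by metis
qed

lemma stable_sum:
  assumes X: "X \<in> stable_subgroups M S" and Y: "Y \<in> stable_subgroups M S" and S: "S \<subseteq> carrier R"
  shows "X <+>\<^bsub>M\<^esub> Y \<in> stable_subgroups M S"
proof -
  have c: "X \<subseteq> carrier M" "Y \<subseteq> carrier M" using X Y by (auto simp: stable_subgroups_iff)
  show ?thesis
    unfolding stable_subgroups_iff set_add_def'
  proof (intro conjI ballI)
    show "(\<Union>h\<in>X. \<Union>k\<in>Y. {h \<oplus>\<^bsub>M\<^esub> k}) \<subseteq> carrier M" using c by auto
    have "\<zero>\<^bsub>M\<^esub> \<oplus>\<^bsub>M\<^esub> \<zero>\<^bsub>M\<^esub> = \<zero>\<^bsub>M\<^esub>" by simp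
    moreover have "\<zero>\<^bsub>M\<^esub> \<in> X" "\<zero>\<^bsub>M\<^esub> \<in> Y" using X Y by (auto simp: stable_subgroups_iff)
    ultimately show "\<zero>\<^bsub>M\<^esub> \<in> (\<Union>h\<in>X. \<Union>k\<in>Y. {h \<oplus>\<^bsub>M\<^esub> k})" by (metis UN_iff singletonI)
  next
    fix a b assume "a \<in> (\<Union>h\<in>X. \<Union>k\<in>Y. {h \<oplus>\<^bsub>M\<^esub> k})" "b \<in> (\<Union>h\<in>X. \<Union>k\<in>Y. {h \<oplus>\<^bsub>M\<^esub> k})"
    then obtain x y x' y' where e: "x \<in> X" "y \<in> Y" "x' \<in> X" "y' \<in> Y"
      "a = x \<oplus>\<^bsub>M\<^esub> y" "b = x' \<oplus>\<^bsub>M\<^esub> y'" by auto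
    have "a \<oplus>\<^bsub>M\<^esub> b = (x \<oplus>\<^bsub>M\<^esub> x') \<oplus>\<^bsub>M\<^esub> (y \<oplus>\<^bsub>M\<^esub> y')"
      using e c by (simp add: M.a_ac subset_iff)
    moreover have "x \<oplus>\<^bsub>M\<^esub> x' \<in> X" "y \<oplus>\<^bsub>M\<^esub> y' \<in> Y" using e X Y by (auto simp: stable_subgroups_iff)
    ultimately show "a \<oplus>\<^bsub>M\<^esub> b \<in> (\<Union>h\<in>X. \<Union>k\<in>Y. {h \<oplus>\<^bsub>M\<^esub> k})" by blast
  next
    fix a assume "a \<in> (\<Union>h\<in>X. \<Union>k\<in>Y. {h \<oplus>\<^bsub>M\<^esub> k})"
    then obtain x y where e: "x \<in> X" "y \<in> Y" "a = x \<oplus>\<^bsub>M\<^esub> y" by auto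
    have "\<ominus>\<^bsub>M\<^esub> a = (\<ominus>\<^bsub>M\<^esub> x) \<oplus>\<^bsub>M\<^esub> (\<ominus>\<^bsub>M\<^esub> y)"
      using e c by (simp add: M.minus_add subset_iff)
    moreover have "\<ominus>\<^bsub>M\<^esub> x \<in> X" "\<ominus>\<^bsub>M\<^esub> y \<in> Y" using e X Y by (auto simp: stable_subgroups_iff)
    ultimately show "\<ominus>\<^bsub>M\<^esub> a \<in> (\<Union>h\<in>X. \<Union>k\<in>Y. {h \<oplus>\<^bsub>M\<^esub> k})" by blast
  next
    fix s a assume s: "s \<in> S" and "a \<in> (\<Union>h\<in>X. \<Union>k\<in>Y. {h \<oplus>\<^bsub>M\<^esub> k})"
    then obtain x y where e: "x \<in> X" "y \<in> Y" "a = x \<oplus>\<^bsub>M\<^esub> y" by auto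
    have "s \<odot>\<^bsub>M\<^esub> a = (s \<odot>\<^bsub>M\<^esub> x) \<oplus>\<^bsub>M\<^esub> (s \<odot>\<^bsub>M\<^esub> y)"
      using e c s S by (simp add: smult_r_distr subset_iff)
    moreover have "s \<odot>\<^bsub>M\<^esub> x \<in> X" "s \<odot>\<^bsub>M\<^esub> y \<in> Y" using e X Y s by (auto simp: stable_subgroups_iff)
    ultimately show "s \<odot>\<^bsub>M\<^esub> a \<in> (\<Union>h\<in>X. \<Union>k\<in>Y. {h \<oplus>\<^bsub>M\<^esub> k})" by blast
  qed
qed

lemma sum_upper:
  assumes "X \<in> stable_subgroups M S" "Y \<in> stable_subgroups M S"
  shows "X \<subseteq> X <+>\<^bsub>M\<^esub> Y" "Y \<subseteq> X <+>\<^bsub>M\<^esub> Y"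
proof -
  have c: "X \<subseteq> carrier M" "Y \<subseteq> carrier M" "\<zero>\<^bsub>M\<^esub> \<in> X" "\<zero>\<^bsub>M\<^esub> \<in> Y"
    using assms by (auto simp: stable_subgroups_iff)
  show "X \<subseteq> X <+>\<^bsub>M\<^esub> Y"
  proof
    fix x assume x: "x \<in> X"
    then have "x = x \<oplus>\<^bsub>M\<^esub> \<zero>\<^bsub>M\<^esub>" using c by auto
    then show "x \<in> X <+>\<^bsub>M\<^esub> Y" using x c unfolding set_add_def' by blast
  qed
  show "Y \<subseteq> X <+>\<^bsub>M\<^esub> Y"
  proof
    fix x assume x: "x \<in> Y"
    then have "x = \<zero>\<^bsub>M\<^esub> \<oplus>\<^bsub>M\<^esub> x" using c by auto
    then show "x \<in> X <+>\<^bsub>M\<^esub> Y" using x c unfolding set_add_def' by blast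
  qed
qed

lemma sum_least:
  assumes "Z \<in> stable_subgroups M S" "X \<subseteq> Z" "Y \<subseteq> Z"
  shows "X <+>\<^bsub>M\<^esub> Y \<subseteq> Z"
  using assms unfolding set_add_def' stable_subgroups_iff by blast

lemma sum_mono: "X \<subseteq> X' \<Longrightarrow> X <+>\<^bsub>M\<^esub> Y \<subseteq> X' <+>\<^bsub>M\<^esub> Y"
  unfolding set_add_def' by blast

text \<open>The modular law, in the form needed for lengths: each strict step of a chain remains strict in at
  least one of the intersections with \<open>B\<close> and the sums with \<open>B\<close>.\<close>
lemma modular_strict:
  assumes X: "X \<in> stable_subgroups M S" and Y: "Y \<in> stable_subgroups M S"
    and B: "B \<in> stable_subgroups M S" and XY: "X \<subset> Y"
    and eq: "X \<inter> B = Y \<inter> B" "X <+>\<^bsub>M\<^esub> B = Y <+>\<^bsub>M\<^esub> B"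
  shows False
proof -
  obtain y where y: "y \<in> Y" "y \<notin> X" using XY by blast
  have c: "X \<subseteq> carrier M" "B \<subseteq> carrier M" using X B by (auto simp: stable_subgroups_iff)
  have "y \<in> X <+>\<^bsub>M\<^esub> B" using sum_upper(1)[OF Y B] y eq by blast
  then obtain x b where xb: "x \<in> X" "b \<in> B" "y = x \<oplus>\<^bsub>M\<^esub> b" unfolding set_add_def' by blast
  have "b = y \<ominus>\<^bsub>M\<^esub> x" using xb c by (simp add: M.add_minus_cancel subset_iff)
  then have "b \<in> Y" using stable_minus[OF Y] xb y XY by blast
  then have "b \<in> X" using xb eq by blast
  then show False using xb y X by (auto simp: stable_subgroups_iff)
qed

text \<open>Chains below and above \<open>B\<close> can be concatenated, which gives one inequality. For the other one, a
  chain from \<open>A\<close> to \<open>C\<close> is projected to a chain below \<open>B\<close> and a chain above \<open>B\<close>, and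
  \<open>modular_strict\<close> shows that no step is lost in both.\<close>
lemma relative_length_additive:
  assumes A: "A \<in> stable_subgroups M S" and B: "B \<in> stable_subgroups M S"
    and C: "C \<in> stable_subgroups M S" and AB: "A \<subseteq> B" and BC: "B \<subseteq> C" and S: "S \<subseteq> carrier R"
  shows "relative_length M S A C = relative_length M S A B + relative_length M S B C"
proof (rule order_antisym)
  have split: "\<exists>a b. n \<le> a + b \<and> chain_to (stable_between M S A B) a (X \<inter> B) \<and>
      chain_to (stable_between M S B C) b (X <+>\<^bsub>M\<^esub> B)"
    if "chain_to (stable_between M S A C) n X" for n X
    using that
  proof (induction n arbitrary: X)
    case 0
    then have X: "X \<in> stable_subgroups M S" "A \<subseteq> X" "X \<subseteq> C"
      by (auto simp: stable_between_def)
    have "X \<inter> B \<in> stable_between M S A B"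
      using X AB by (auto intro!: stable_betweenI stable_Int B)
    moreover have "X <+>\<^bsub>M\<^esub> B \<in> stable_between M S B C"
      using stable_betweenI[OF stable_sum[OF X(1) B S]] sum_upper(2)[OF X(1) B] sum_least[OF C X(3) BC]
      by blast
    ultimately show ?case by (intro exI[of _ 0]) auto
  next
    case (Suc n)
    then obtain Y where Y: "Y \<subset> X" "chain_to (stable_between M S A C) n Y"
      unfolding chain_to.simps by blast
    from Suc.IH[OF Y(2)] obtain a b where ab: "n \<le> a + b"
      "chain_to (stable_between M S A B) a (Y \<inter> B)" "chain_to (stable_between M S B C) b (Y <+>\<^bsub>M\<^esub> B)"
      by blast
    have X: "X \<in> stable_subgroups M S" "A \<subseteq> X" "X \<subseteq> C" and Y': "Y \<in> stable_subgroups M S"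
      using chain_to_mem[OF Suc.prems] chain_to_mem[OF Y(2)] by (auto simp: stable_between_def)
    have 1: "X \<inter> B \<in> stable_between M S A B"
      using X AB by (auto intro!: stable_betweenI stable_Int B)
    have 2: "X <+>\<^bsub>M\<^esub> B \<in> stable_between M S B C"
      using stable_betweenI[OF stable_sum[OF X(1) B S]] sum_upper(2)[OF X(1) B] sum_least[OF C X(3) BC]
      by blast
    have m: "Y \<inter> B \<subseteq> X \<inter> B" "Y <+>\<^bsub>M\<^esub> B \<subseteq> X <+>\<^bsub>M\<^esub> B" using Y sum_mono[of Y X] by auto
    have l: "chain_to (stable_between M S A B) a (X \<inter> B)"
      "chain_to (stable_between M S B C) b (X <+>\<^bsub>M\<^esub> B)"
      using chain_to_raise ab m 1 2 by blast+
    consider "Y \<inter> B \<subset> X \<inter> B" | "Y <+>\<^bsub>M\<^esub> B \<subset> X <+>\<^bsub>M\<^esub> B"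
      using modular_strict[OF Y' X(1) B Y(1)] m by blast
    then show ?case
    proof cases
      case c: 1
      have "chain_to (stable_between M S A B) (Suc a) (X \<inter> B)"
        unfolding chain_to.simps by (intro conjI 1 exI[of _ "Y \<inter> B"] c ab)
      then show ?thesis using ab(1) l(2) by (intro exI[of _ "Suc a"] exI[of _ b]) auto
    next
      case c: 2
      have "chain_to (stable_between M S B C) (Suc b) (X <+>\<^bsub>M\<^esub> B)"
        unfolding chain_to.simps by (intro conjI 2 exI[of _ "Y <+>\<^bsub>M\<^esub> B"] c ab)
      then show ?thesis using ab(1) l(1) by (intro exI[of _ a] exI[of _ "Suc b"]) auto
    qed
  qed
  show "relative_length M S A C \<le> relative_length M S A B + relative_length M S B C"
    unfolding relative_length_def
  proof (rule chain_height_least)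
    fix n X assume "chain_to (stable_between M S A C) n X"
    from split[OF this] obtain a b where ab: "n \<le> a + b"
      "chain_to (stable_between M S A B) a (X \<inter> B)"
      "chain_to (stable_between M S B C) b (X <+>\<^bsub>M\<^esub> B)" by blast
    have "enat n \<le> enat a + enat b" using ab by simp
    also have "\<dots> \<le> chain_height (stable_between M S A B) + chain_height (stable_between M S B C)"
      by (intro add_mono chain_height_upper[OF ab(2)] chain_height_upper[OF ab(3)])
    finally show "enat n \<le> \<dots>" .
  qed
next
  have join: "chain_to (stable_between M S A C) (a + b) Y"
    if a: "chain_to (stable_between M S A B) a X" and b: "chain_to (stable_between M S B C) b Y" for a b X Y
    using b
  proof (induction b arbitrary: Y)
    case 0
    have "chain_to (stable_between M S A C) a X"
      by (rule chain_to_map[where f = "\<lambda>X. X", OF _ _ a]) (use BC in \<open>auto simp: stable_between_def\<close>)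
    moreover have "X \<subseteq> Y" "Y \<in> stable_between M S A C"
      using 0 chain_to_mem[OF a] AB by (auto simp: stable_between_def)
    ultimately show ?case using chain_to_raise[of _ a X Y] by simp
  next
    case (Suc b)
    then obtain Z where "Z \<subset> Y" "chain_to (stable_between M S B C) b Z"
      "Y \<in> stable_between M S B C" unfolding chain_to.simps by blast
    moreover from this have "Y \<in> stable_between M S A C" using AB by (auto simp: stable_between_def)
    ultimately show ?case using Suc.IH[of Z] by (auto simp: chain_to.simps(2))
  qed
  have ne: "stable_between M S A B \<noteq> {}" "stable_between M S B C \<noteq> {}"
    using assms by (auto simp: stable_between_def)
  let ?l = "relative_length M S A C"
  have *: "enat (a + b) \<le> ?l"
    if a: "enat a \<le> relative_length M S A B" and b: "enat b \<le> relative_length M S B C" for a b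
  proof -
    obtain X where "chain_to (stable_between M S A B) a X"
      using chain_height_attained[OF ne(1)] a unfolding relative_length_def by blast
    moreover obtain Y where "chain_to (stable_between M S B C) b Y"
      using chain_height_attained[OF ne(2)] b unfolding relative_length_def by blast
    ultimately show ?thesis unfolding relative_length_def by (intro chain_height_upper join)
  qed
  show "relative_length M S A B + relative_length M S B C \<le> ?l"
  proof (cases ?l)
    case (enat l)
    have f1: "relative_length M S A B \<noteq> \<infinity>"
      using *[of "Suc l" 0] enat by (intro notI) (simp add: zero_enat_def[symmetric])
    have f2: "relative_length M S B C \<noteq> \<infinity>"
      using *[of 0 "Suc l"] enat by (intro notI) (simp add: zero_enat_def[symmetric])
    from f1 f2 show ?thesis using * by auto
  qed simp
qed

lemma relative_length_mono:
  assumes "S \<subseteq> T" "A' \<subseteq> A" "B \<subseteq> B'"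
  shows "relative_length M T A B \<le> relative_length M S A' B'"
  unfolding relative_length_def
  by (rule chain_height_mono) (use assms in \<open>auto simp: stable_between_def stable_subgroups_def\<close>)

lemma relative_length_self: "relative_length M S A A = 0"
proof -
  have "n = 0" if X: "chain_to (stable_between M S A A) n X" for n X
  proof (cases n)
    case (Suc k)
    obtain Y where "Y \<subset> X" "X \<in> stable_between M S A A" "chain_to (stable_between M S A A) k Y"
      using X unfolding Suc chain_to.simps by blast
    moreover from this(3) have "Y \<in> stable_between M S A A" by (rule chain_to_mem)
    ultimately show ?thesis by (auto simp: stable_between_def)
  qed
  then have "chain_height (stable_between M S A A) \<le> 0"
    by (intro chain_height_least) (simp add: zero_enat_def)
  then show ?thesis unfolding relative_length_def by simp
qed

lemma abelian_subgroup_of_stable: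
  "N \<in> stable_subgroups M S \<Longrightarrow> abelian_subgroup N M"
  by (intro abelian_subgroupI3 additive_subgroup.intro) (auto simp: stable_subgroups_def M.abelian_group_axioms)

lemma coset_eq_iff:
  assumes N: "N \<in> stable_subgroups M S" and "x \<in> carrier M" "y \<in> carrier M"
  shows "N +>\<^bsub>M\<^esub> x = N +>\<^bsub>M\<^esub> y \<longleftrightarrow> x \<ominus>\<^bsub>M\<^esub> y \<in> N"
proof -
  interpret abelian_subgroup N M by (rule abelian_subgroup_of_stable[OF N])
  show ?thesis
  proof
    assume "N +>\<^bsub>M\<^esub> x = N +>\<^bsub>M\<^esub> y"
    then have "x \<in> N +>\<^bsub>M\<^esub> y" using a_rcos_self[OF assms(2)] by simp
    then show "x \<ominus>\<^bsub>M\<^esub> y \<in> N" using a_rcos_module[of y x] assms by (simp add: a_minus_def)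
  next
    assume "x \<ominus>\<^bsub>M\<^esub> y \<in> N"
    then have "x \<in> N +>\<^bsub>M\<^esub> y" using a_rcos_module[of y x] assms by (simp add: a_minus_def)
    then show "N +>\<^bsub>M\<^esub> x = N +>\<^bsub>M\<^esub> y" using a_repr_independence'[of x y] assms by simp
  qed
qed

end

section \<open>Quotient modules\<close>

context module
begin

text \<open>The correspondence theorem for \<open>U / N\<close>. The ring \<open>L\<close> acts through a map \<open>\<phi>\<close> of scalars, so that
  the statement covers both \<open>M / N\<close> over \<open>R\<close> and a graded piece of \<open>M / N\<close> over the base field.\<close>
lemma module_length_eq_relative_length:
  assumes N: "N \<in> stable_subgroups M S" and U: "U \<in> stable_subgroups M S" and NU: "N \<subseteq> U"
    and S: "S = \<phi> ` carrier L"
    and Q: "carrier Q = (\<lambda>m. N +>\<^bsub>M\<^esub> m) ` U" "zero Q = N" "add Q = set_add M"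
    and smult_Q: "\<And>c m. c \<in> carrier L \<Longrightarrow> m \<in> U \<Longrightarrow> c \<odot>\<^bsub>Q\<^esub> (N +>\<^bsub>M\<^esub> m) = N +>\<^bsub>M\<^esub> (\<phi> c \<odot>\<^bsub>M\<^esub> m)"
  shows "module_length L Q = relative_length M S N U"
proof -
  let ?p = "\<lambda>m. N +>\<^bsub>M\<^esub> m"
  interpret N: abelian_subgroup N M by (rule abelian_subgroup_of_stable[OF N])
  have Nc: "N \<subseteq> carrier M" and Uc: "U \<subseteq> carrier M" and U0: "\<zero>\<^bsub>M\<^esub> \<in> U"
    and Uadd: "\<And>x y. x \<in> U \<Longrightarrow> y \<in> U \<Longrightarrow> x \<oplus>\<^bsub>M\<^esub> y \<in> U"
    and Uinv: "\<And>x. x \<in> U \<Longrightarrow> \<ominus>\<^bsub>M\<^esub> x \<in> U"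
    and Us: "\<And>a x. a \<in> S \<Longrightarrow> x \<in> U \<Longrightarrow> a \<odot>\<^bsub>M\<^esub> x \<in> U"
    using N U by (auto simp: stable_subgroups_iff)
  have pN: "?p \<zero>\<^bsub>M\<^esub> = N" using Nc by (simp add: M.a_coset_add_zero)
  have padd: "?p x <+>\<^bsub>M\<^esub> ?p y = ?p (x \<oplus>\<^bsub>M\<^esub> y)" if "x \<in> U" "y \<in> U" for x y
    using N.a_rcos_sum that Uc by blast
  have peq: "?p x = ?p y \<longleftrightarrow> x \<ominus>\<^bsub>M\<^esub> y \<in> N" if "x \<in> U" "y \<in> U" for x y
    using coset_eq_iff[OF N] that Uc by blast
  have grp: "group (add_monoid Q)"
  proof (rule groupI, goal_cases)
    case (1 x y) then show ?case using padd Uadd by (auto simp: Q)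
  next
    case 2 then show ?case using U0 pN by (auto simp: Q)
  next
    case (3 x y z) then show ?case using padd Uadd Uc by (auto simp: Q M.a_assoc subset_iff)
  next
    case (4 x)
    then obtain u where u: "u \<in> U" "x = ?p u" by (auto simp: Q)
    then have "N <+>\<^bsub>M\<^esub> ?p u = ?p (\<zero>\<^bsub>M\<^esub> \<oplus>\<^bsub>M\<^esub> u)" using padd[OF U0, of u] by (simp only: pN)
    then show ?case using u Uc by (auto simp: Q)
  next
    case (5 x)
    then obtain u where u: "u \<in> U" "x = ?p u" by (auto simp: Q)
    then have "?p (\<ominus>\<^bsub>M\<^esub> u) <+>\<^bsub>M\<^esub> ?p u = ?p (\<ominus>\<^bsub>M\<^esub> u \<oplus>\<^bsub>M\<^esub> u)" using padd Uinv by blast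
    then have "?p (\<ominus>\<^bsub>M\<^esub> u) <+>\<^bsub>M\<^esub> ?p u = N" using u Uc pN by (simp add: M.l_neg subset_iff)
    then show ?case using u Uinv by (auto simp: Q)
  qed
  \<comment> \<open>The inverse in \<open>Q\<close> is defined by a description operator over the carrier of \<open>Q\<close>, so it has to be
    identified before submodules of \<open>Q\<close> can be pulled back.\<close>
  have pinv: "inv\<^bsub>add_monoid Q\<^esub> ?p u = ?p (\<ominus>\<^bsub>M\<^esub> u)" if u: "u \<in> U" for u
  proof (rule group.inv_equality[OF grp])
    have "?p (\<ominus>\<^bsub>M\<^esub> u) <+>\<^bsub>M\<^esub> ?p u = ?p (\<ominus>\<^bsub>M\<^esub> u \<oplus>\<^bsub>M\<^esub> u)" using u padd Uinv by blast
    then have "?p (\<ominus>\<^bsub>M\<^esub> u) <+>\<^bsub>M\<^esub> ?p u = N" using u Uc pN by (simp add: M.l_neg subset_iff)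
    then show "?p (\<ominus>\<^bsub>M\<^esub> u) \<otimes>\<^bsub>add_monoid Q\<^esub> ?p u = \<one>\<^bsub>add_monoid Q\<^esub>" by (simp add: Q)
  qed (use u Uinv in \<open>auto simp: Q\<close>)
  have pinv': "\<ominus>\<^bsub>Q\<^esub> ?p u = ?p (\<ominus>\<^bsub>M\<^esub> u)" if "u \<in> U" for u
    using pinv[OF that] by (simp add: a_inv_def)
  define g where "g D = {u \<in> U. ?p u \<in> D}" for D
  show ?thesis
    unfolding module_length_eq_chain_height relative_length_def
  proof (rule chain_height_eq_by_maps[where f = g and g = "\<lambda>C. ?p ` C"])
    fix D assume "D \<in> {H. submodule H L Q}"
    then have D: "D \<subseteq> ?p ` U" "N \<in> D" "\<And>x y. x \<in> D \<Longrightarrow> y \<in> D \<Longrightarrow> x <+>\<^bsub>M\<^esub> y \<in> D"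
      "\<And>x. x \<in> D \<Longrightarrow> \<ominus>\<^bsub>Q\<^esub> x \<in> D" "\<And>a x. a \<in> carrier L \<Longrightarrow> x \<in> D \<Longrightarrow> a \<odot>\<^bsub>Q\<^esub> x \<in> D"
      by (auto simp: submodule_iff_stable stable_subgroups_iff Q)
    show "g D \<in> stable_between M S N U"
    proof (rule stable_betweenI)
      show "g D \<in> stable_subgroups M S"
        unfolding stable_subgroups_iff
      proof (intro conjI ballI)
        show "g D \<subseteq> carrier M" using Uc by (auto simp: g_def)
        show "\<zero>\<^bsub>M\<^esub> \<in> g D" using U0 D by (auto simp: g_def pN)
      next
        fix x y assume "x \<in> g D" "y \<in> g D"
        then show "x \<oplus>\<^bsub>M\<^esub> y \<in> g D" using Uadd D(3) padd by (fastforce simp: g_def)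
      next
        fix x assume "x \<in> g D"
        then show "\<ominus>\<^bsub>M\<^esub> x \<in> g D" using Uinv D(4) pinv' by (fastforce simp: g_def)
      next
        fix a x assume "a \<in> S" "x \<in> g D"
        then show "a \<odot>\<^bsub>M\<^esub> x \<in> g D" using Us D(5) smult_Q S by (fastforce simp: g_def)
      qed
      show "N \<subseteq> g D"
      proof
        fix x assume x: "x \<in> N"
        then have "?p x = N" using N.a_rcos_const by blast
        then show "x \<in> g D" using x NU D by (auto simp: g_def)
      qed
    qed (auto simp: g_def)
  next
    fix D E assume "D \<in> {H. submodule H L Q}" "E \<in> {H. submodule H L Q}" "D \<subset> E"
    then have "E \<subseteq> ?p ` U" "D \<subset> E" by (auto simp: submodule_iff_stable stable_subgroups_iff Q)
    then show "g D \<subset> g E" by (auto simp: g_def)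
  next
    fix C assume C: "C \<in> stable_between M S N U"
    note CD = stable_betweenD[OF C]
    have C1: "\<zero>\<^bsub>M\<^esub> \<in> C" "\<And>x y. x \<in> C \<Longrightarrow> y \<in> C \<Longrightarrow> x \<oplus>\<^bsub>M\<^esub> y \<in> C"
      "\<And>x. x \<in> C \<Longrightarrow> \<ominus>\<^bsub>M\<^esub> x \<in> C" "\<And>a x. a \<in> S \<Longrightarrow> x \<in> C \<Longrightarrow> a \<odot>\<^bsub>M\<^esub> x \<in> C"
      using CD(1) by (auto simp: stable_subgroups_iff)
    have "?p ` C \<in> stable_subgroups Q (carrier L)"
      unfolding stable_subgroups_iff
    proof (intro conjI ballI)
      show "?p ` C \<subseteq> carrier Q" using CD(3) by (auto simp: Q)
      show "\<zero>\<^bsub>Q\<^esub> \<in> ?p ` C" using C1(1) pN by (force simp: Q)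
    next
      fix x y assume "x \<in> ?p ` C" "y \<in> ?p ` C"
      then obtain u v where uv: "u \<in> C" "v \<in> C" "x = ?p u" "y = ?p v" by auto
      then have "u \<in> U" "v \<in> U" using CD(3) by auto
      then show "x \<oplus>\<^bsub>Q\<^esub> y \<in> ?p ` C" using uv C1(2) padd by (auto simp: Q)
    next
      fix x assume "x \<in> ?p ` C"
      then obtain u where u: "u \<in> C" "x = ?p u" by auto
      then have "u \<in> U" using CD(3) by auto
      then show "\<ominus>\<^bsub>Q\<^esub> x \<in> ?p ` C" using u C1(3) pinv' by auto
    next
      fix a x assume a: "a \<in> carrier L" and "x \<in> ?p ` C"
      then obtain u where u: "u \<in> C" "x = ?p u" by auto
      then have "u \<in> U" using CD(3) by auto
      then show "a \<odot>\<^bsub>Q\<^esub> x \<in> ?p ` C" using a u C1(4) S smult_Q by auto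
    qed
    then show "?p ` C \<in> {H. submodule H L Q}" by (simp add: submodule_iff_stable)
  next
    fix C E assume C: "C \<in> stable_between M S N U" and E: "E \<in> stable_between M S N U" and "C \<subset> E"
    then obtain e where e: "e \<in> E" "e \<notin> C" by blast
    note CD = stable_betweenD[OF C] and ED = stable_betweenD[OF E]
    have "?p e \<notin> ?p ` C"
    proof
      assume "?p e \<in> ?p ` C"
      then obtain c where c: "c \<in> C" "?p e = ?p c" by blast
      have eU: "e \<in> U" "c \<in> U" using e c CD(3) ED(3) by auto
      then have "e \<ominus>\<^bsub>M\<^esub> c \<in> C" using c peq CD(2) by blast
      then have "(e \<ominus>\<^bsub>M\<^esub> c) \<oplus>\<^bsub>M\<^esub> c \<in> C" using c CD(1) by (auto simp: stable_subgroups_iff)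
      then show False using e eU Uc by (simp add: M.add_minus_cancel subset_iff)
    qed
    then show "?p ` C \<subset> ?p ` E" using \<open>C \<subset> E\<close> e by blast
  qed
qed

lemma quotient_module_smult:
  assumes N: "N \<in> stable_subgroups M (carrier R)" and r: "r \<in> carrier R" and m: "m \<in> carrier M"
  shows "r \<odot>\<^bsub>quotient_module M N\<^esub> (N +>\<^bsub>M\<^esub> m) = N +>\<^bsub>M\<^esub> (r \<odot>\<^bsub>M\<^esub> m)"
proof -
  interpret N: abelian_subgroup N M by (rule abelian_subgroup_of_stable[OF N])
  have "N +>\<^bsub>M\<^esub> (r \<odot>\<^bsub>M\<^esub> x) = N +>\<^bsub>M\<^esub> (r \<odot>\<^bsub>M\<^esub> m)" if x: "x \<in> N +>\<^bsub>M\<^esub> m" for x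
  proof -
    have xc: "x \<in> carrier M" using x N.a_elemrcos_carrier m by blast
    have "x \<oplus>\<^bsub>M\<^esub> \<ominus>\<^bsub>M\<^esub> m \<in> N" using x N.a_rcos_module[of m x] m xc by blast
    then have "r \<odot>\<^bsub>M\<^esub> (x \<oplus>\<^bsub>M\<^esub> \<ominus>\<^bsub>M\<^esub> m) \<in> N" using N r by (auto simp: stable_subgroups_iff)
    then have "(r \<odot>\<^bsub>M\<^esub> x) \<ominus>\<^bsub>M\<^esub> (r \<odot>\<^bsub>M\<^esub> m) \<in> N"
      using r xc m by (simp add: smult_r_distr smult_r_minus a_minus_def)
    then show ?thesis using coset_eq_iff[OF N] r xc m by simp
  qed
  moreover have "m \<in> N +>\<^bsub>M\<^esub> m" by (rule N.a_rcos_self[OF m])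
  ultimately have "(\<Union>x\<in>N +>\<^bsub>M\<^esub> m. N +>\<^bsub>M\<^esub> (r \<odot>\<^bsub>M\<^esub> x)) = N +>\<^bsub>M\<^esub> (r \<odot>\<^bsub>M\<^esub> m)" by blast
  then show ?thesis by (simp add: quotient_module_def)
qed

lemma carrier_stable: "S \<subseteq> carrier R \<Longrightarrow> carrier M \<in> stable_subgroups M S"
  by (auto simp: stable_subgroups_iff subset_iff)

lemma module_length_quotient_module:
  assumes N: "N \<in> stable_subgroups M (carrier R)"
  shows "module_length R (quotient_module M N) = relative_length M (carrier R) N (carrier M)"
proof (rule module_length_eq_relative_length[where \<phi> = "\<lambda>x. x"])
  show "carrier (quotient_module M N) = (\<lambda>m. N +>\<^bsub>M\<^esub> m) ` carrier M"
    by (auto simp: quotient_module_def A_RCOSETS_def')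
qed (use N in \<open>auto simp: carrier_stable quotient_module_smult stable_subgroups_iff\<close>,
     simp_all add: quotient_module_def)

lemma span_least:
  assumes "N \<in> stable_subgroups M (carrier R)" "X \<subseteq> N"
  shows "module_span R M X \<subseteq> N"
  using assms by (auto simp: module_span_def submodule_iff_stable)

lemma span_superset: "X \<subseteq> module_span R M X"
  by (auto simp: module_span_def)

lemma span_stable:
  assumes "X \<subseteq> carrier M"
  shows "module_span R M X \<in> stable_subgroups M (carrier R)"
proof -
  have "module_span R M X \<subseteq> carrier M"
    by (rule span_least) (use assms carrier_stable in auto)
  then show ?thesis by (auto simp: module_span_def submodule_iff_stable stable_subgroups_iff)
qed

end

lemma regular_module_is_module: "cring R \<Longrightarrow> module R (regular_module R)"
proof -
  assume "cring R"
  then interpret cring R .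
  have "abelian_group (regular_module R)"
    by (intro abelian_groupI) (auto simp: regular_module_def a_ac intro!: bexI[of _ "\<ominus>\<^bsub>R\<^esub> _"] l_neg)
  then show ?thesis
    by (intro moduleI is_cring) (auto simp: regular_module_def l_distr r_distr m_assoc)
qed

lemma additive_subgroup_regular_module:
  "subgroup H (add_monoid (regular_module R)) \<longleftrightarrow> subgroup H (add_monoid R)"
  by (simp add: subgroup_def m_inv_def regular_module_def)

lemma regular_module_simps:
  "carrier (regular_module R) = carrier R" "add (regular_module R) = add R"
  "zero (regular_module R) = zero R" "smult (regular_module R) = monoid.mult R"
  by (simp_all add: regular_module_def)

text \<open>Ideals of \<open>R\<close> are thus covered by everything that is proved about submodules.\<close>
lemma ideal_iff_stable_regular:
  assumes "cring R"
  shows "ideal J R \<longleftrightarrow> J \<in> stable_subgroups (regular_module R) (carrier R)"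
proof -
  interpret cring R by fact
  have "J \<subseteq> carrier R" if "subgroup J (add_monoid R)" using that by (simp add: additive_subgroup_iff)
  then show ?thesis
    unfolding ideal_def ideal_axioms_def stable_subgroups_def additive_subgroup_regular_module
      additive_subgroup_def
    unfolding regular_module_simps
    using ring_axioms by (auto simp: subset_iff) (metis m_comm)+
qed

lemma (in cring) ideal_if_stable:
  assumes "subgroup J (add_monoid R)" "\<And>a r. a \<in> J \<Longrightarrow> r \<in> carrier R \<Longrightarrow> r \<otimes> a \<in> J"
  shows "ideal J R"
  using assms unfolding ideal_iff_stable_regular[OF is_cring] stable_subgroups_def
    additive_subgroup_regular_module
  by (simp add: regular_module_simps)

section \<open>Homogeneous components\<close>

text \<open>The index set is arbitrary, so that rings graded by natural numbers and modules graded by integers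
  are both instances.\<close>
locale graded_group = abelian_group G for G (structure) +
  fixes A :: "'i \<Rightarrow> 'a set"
  assumes decomposition: "internal_direct_sum G A"
begin

definition is_decomposition :: "'a \<Rightarrow> ('i \<Rightarrow> 'a) \<Rightarrow> bool" where
  "is_decomposition x f \<longleftrightarrow> (\<forall>i. f i \<in> A i) \<and> finite {i. f i \<noteq> \<zero>} \<and>
     x = (\<Oplus>i\<in>{i. f i \<noteq> \<zero>}. f i)"

definition component :: "'i \<Rightarrow> 'a \<Rightarrow> 'a" where
  "component i x = (THE f. is_decomposition x f) i"

lemma piece_subgroup: "subgroup (A i) (add_monoid G)"
  using decomposition by (simp add: internal_direct_sum_def)

lemma piece_subset: "A i \<subseteq> carrier G"
  using piece_subgroup[of i] by (simp add: additive_subgroup_iff)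

lemma piece_carrier: "x \<in> A i \<Longrightarrow> x \<in> carrier G"
  using piece_subset by blast

lemma ex1_decomposition: "x \<in> carrier G \<Longrightarrow> \<exists>!f. is_decomposition x f"
  using decomposition by (simp add: internal_direct_sum_def is_decomposition_def)

lemma component_decomposition: "x \<in> carrier G \<Longrightarrow> is_decomposition x (\<lambda>i. component i x)"
  using theI'[of "is_decomposition x"] ex1_decomposition by (simp add: component_def)

lemma component_unique:
  assumes "is_decomposition x f" "x \<in> carrier G"
  shows "component i x = f i"
  using the1_equality[of "is_decomposition x" f] ex1_decomposition[OF assms(2)] assms(1)
  by (simp add: component_def)

lemma component_mem: "x \<in> carrier G \<Longrightarrow> component i x \<in> A i"
  using component_decomposition by (simp add: is_decomposition_def)

lemma component_carrier [simp, intro]: "x \<in> carrier G \<Longrightarrow> component i x \<in> carrier G"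
  using component_mem piece_carrier by blast

lemma finite_support: "x \<in> carrier G \<Longrightarrow> finite {i. component i x \<noteq> \<zero>}"
  using component_decomposition by (simp add: is_decomposition_def)

lemma component_sum: "x \<in> carrier G \<Longrightarrow> x = (\<Oplus>i\<in>{i. component i x \<noteq> \<zero>}. component i x)"
  using component_decomposition by (simp add: is_decomposition_def)

lemma finsum_superset:
  assumes "finite F" "{i. f i \<noteq> \<zero>} \<subseteq> F" "\<And>i. f i \<in> carrier G"
  shows "(\<Oplus>i\<in>{i. f i \<noteq> \<zero>}. f i) = (\<Oplus>i\<in>F. f i)"
  by (rule add.finprod_mono_neutral_cong_left) (use assms in auto)

lemma is_decompositionI:
  assumes "\<And>i. f i \<in> A i" "finite F" "\<And>i. i \<notin> F \<Longrightarrow> f i = \<zero>" "x = (\<Oplus>i\<in>F. f i)"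
  shows "is_decomposition x f"
proof -
  have "{i. f i \<noteq> \<zero>} \<subseteq> F" using assms(3) by blast
  then show ?thesis
    using finsum_superset[of F f] assms piece_carrier finite_subset unfolding is_decomposition_def by metis
qed

lemma component_add:
  assumes "x \<in> carrier G" "y \<in> carrier G"
  shows "component i (x \<oplus> y) = component i x \<oplus> component i y"
proof (rule component_unique)
  let ?F = "{i. component i x \<noteq> \<zero>} \<union> {i. component i y \<noteq> \<zero>}"
  have F: "finite ?F" using finite_support assms by simp
  show "is_decomposition (x \<oplus> y) (\<lambda>i. component i x \<oplus> component i y)"
  proof (rule is_decompositionI[OF _ F])
    show "component i x \<oplus> component i y \<in> A i" for i
      using piece_subgroup[of i] component_mem assms by (simp add: additive_subgroup_iff)
    show "component i x \<oplus> component i y = \<zero>" if "i \<notin> ?F" for i using that by simp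
    have "x = (\<Oplus>i\<in>?F. component i x)"
      using component_sum[OF assms(1)] finsum_superset[of ?F "\<lambda>i. component i x"] F assms by auto
    moreover have "y = (\<Oplus>i\<in>?F. component i y)"
      using component_sum[OF assms(2)] finsum_superset[of ?F "\<lambda>i. component i y"] F assms by auto
    moreover have "(\<Oplus>i\<in>?F. component i x \<oplus> component i y) =
        (\<Oplus>i\<in>?F. component i x) \<oplus> (\<Oplus>i\<in>?F. component i y)"
      by (rule add.finprod_multf) (use assms in auto)
    ultimately show "x \<oplus> y = (\<Oplus>i\<in>?F. component i x \<oplus> component i y)" by simp
  qed
qed (use assms in simp)

lemma component_homogeneous:
  assumes "x \<in> A i"
  shows "component j x = (if j = i then x else \<zero>)"
proof (rule component_unique)
  show "is_decomposition x (\<lambda>j. if j = i then x else \<zero>)"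
  proof (rule is_decompositionI[of _ "{i}"])
    show "(if j = i then x else \<zero>) \<in> A j" for j
      using assms piece_subgroup[of j] by (auto simp: additive_subgroup_iff)
  qed (use assms piece_carrier in auto)
qed (use assms piece_carrier in blast)

lemma component_zero: "component i \<zero> = \<zero>"
  using component_homogeneous[of \<zero> i i] piece_subgroup[of i] by (simp add: additive_subgroup_iff)

lemma component_inv:
  assumes "x \<in> carrier G"
  shows "component i (\<ominus> x) = \<ominus> component i x"
proof -
  have "component i (\<ominus> x) \<oplus> component i x = \<zero>"
    using component_add[of "\<ominus> x" x i] assms by (simp add: l_neg component_zero)
  then show ?thesis using assms by (metis a_inv_closed component_carrier minus_equality)
qed

lemma component_minus:
  assumes "x \<in> carrier G" "y \<in> carrier G"
  shows "component i (x \<ominus> y) = component i x \<ominus> component i y"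
  using assms by (simp add: a_minus_def component_add component_inv)

lemma component_component:
  "x \<in> carrier G \<Longrightarrow> component j (component i x) = (if j = i then component i x else \<zero>)"
  using component_homogeneous component_mem by blast

lemma component_remove:
  assumes "x \<in> carrier G"
  shows "component i (x \<ominus> component j x) = (if i = j then \<zero> else component i x)"
  using assms by (simp add: component_minus component_component) (simp add: a_minus_def r_neg)

lemma finsum_mem_subgroup:
  assumes H: "subgroup H (add_monoid G)" and "finite F" "\<And>i. i \<in> F \<Longrightarrow> f i \<in> H"
  shows "(\<Oplus>i\<in>F. f i) \<in> H"
  using assms(2,3)
proof (induction F rule: finite_induct)
  case empty
  then show ?case using H by (simp add: additive_subgroup_iff)
next
  case (insert i F)
  have "H \<subseteq> carrier G" using H by (simp add: additive_subgroup_iff)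
  then have "(\<Oplus>i\<in>insert i F. f i) = f i \<oplus> (\<Oplus>i\<in>F. f i)"
    using insert by (intro finsum_insert) auto
  then show ?case using insert H by (simp add: additive_subgroup_iff)
qed

lemma mem_subgroup_if_components:
  assumes "subgroup H (add_monoid G)" "x \<in> carrier G" "\<And>i. component i x \<in> H"
  shows "x \<in> H"
  using finsum_mem_subgroup[OF assms(1) finite_support[OF assms(2)], of "\<lambda>i. component i x"]
    component_sum[OF assms(2)] assms(3) by simp

text \<open>The induction principle of a grading: additive statements need to be checked on homogeneous
  elements only.\<close>
lemma carrier_subset_if_homogeneous:
  assumes "subgroup H (add_monoid G)" "\<And>i. A i \<subseteq> H"
  shows "carrier G \<subseteq> H"
  using mem_subgroup_if_components[OF assms(1)] component_mem assms(2) by blast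

end

section \<open>The degree filtration of a graded module\<close>

locale module_over_graded_ring = int_graded_module R M Rd Md + R_graded: graded_group R Rd
  for R :: "('r, 'd) ring_scheme" (structure) and M :: "('r, 'm, 'e) module_scheme" (structure)
    and Rd :: "nat \<Rightarrow> 'r set" and Md :: "int \<Rightarrow> 'm set"
begin

sublocale M_graded: graded_group M Md
  by unfold_locales (rule direct_sum)

abbreviation part :: "int \<Rightarrow> 'm \<Rightarrow> 'm" where "part \<equiv> M_graded.component"

lemma scalar_subgroup:
  assumes H: "subgroup H (add_monoid M)" and x: "x \<in> carrier M"
  shows "subgroup {r \<in> carrier R. r \<odot>\<^bsub>M\<^esub> x \<in> H} (add_monoid R)"
  using assms by (auto simp: additive_subgroup_iff smult_l_distr smult_l_minus)

lemma smult_closed_if_homogeneous: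
  assumes H: "subgroup H (add_monoid M)" and x: "x \<in> carrier M"
    and hom: "\<And>n r. r \<in> Rd n \<Longrightarrow> r \<odot>\<^bsub>M\<^esub> x \<in> H" and r: "r \<in> carrier R"
  shows "r \<odot>\<^bsub>M\<^esub> x \<in> H"
proof -
  have "carrier R \<subseteq> {r \<in> carrier R. r \<odot>\<^bsub>M\<^esub> x \<in> H}"
    by (rule R_graded.carrier_subset_if_homogeneous[OF scalar_subgroup[OF H x]])
      (use hom R_graded.piece_carrier in auto)
  then show ?thesis using r by blast
qed

text \<open>Both sides are additive in \<open>x\<close>, so it suffices to consider homogeneous \<open>x\<close>.\<close>
lemma component_smult:
  assumes r: "r \<in> Rd n" and x: "x \<in> carrier M"
  shows "part j (r \<odot>\<^bsub>M\<^esub> x) = r \<odot>\<^bsub>M\<^esub> part (j - int n) x"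
proof -
  let ?H = "{x \<in> carrier M. \<forall>j. part j (r \<odot>\<^bsub>M\<^esub> x) = r \<odot>\<^bsub>M\<^esub> part (j - int n) x}"
  have rc: "r \<in> carrier R" using r R_graded.piece_carrier by blast
  have "carrier M \<subseteq> ?H"
  proof (rule M_graded.carrier_subset_if_homogeneous)
    show "subgroup ?H (add_monoid M)"
      using rc by (auto simp: additive_subgroup_iff smult_r_distr smult_r_minus
          M_graded.component_add M_graded.component_inv M_graded.component_zero)
    show "Md i \<subseteq> ?H" for i
    proof
      fix m assume m: "m \<in> Md i"
      have "r \<odot>\<^bsub>M\<^esub> m \<in> Md (int n + i)" by (rule smult_degree[OF r m])
      then show "m \<in> ?H"
        using m rc M_graded.piece_carrier by (auto simp: M_graded.component_homogeneous)
    qed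
  qed
  then show ?thesis using x by blast
qed

definition homogeneous_submodule :: "'m set \<Rightarrow> bool" where
  "homogeneous_submodule N \<longleftrightarrow>
     N \<in> stable_subgroups M (carrier R) \<and> (\<forall>x\<in>N. \<forall>j. part j x \<in> N)"

text \<open>The elements with all components in \<open>N\<close> form a submodule that contains the generators.\<close>
lemma homogeneous_if_generated:
  assumes N: "N \<in> stable_subgroups M (carrier R)" and X: "X \<subseteq> N" "X \<subseteq> (\<Union>j. Md j)"
    and least: "\<And>L. L \<in> stable_subgroups M (carrier R) \<Longrightarrow> X \<subseteq> L \<Longrightarrow> N \<subseteq> L"
  shows "homogeneous_submodule N"
proof -
  let ?L = "{x \<in> carrier M. \<forall>j. part j x \<in> N}"
  have Nadd: "subgroup N (add_monoid M)" using N by (simp add: stable_subgroups_def)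
  have Ladd: "subgroup ?L (add_monoid M)"
    using Nadd by (auto simp: additive_subgroup_iff M_graded.component_add
        M_graded.component_inv M_graded.component_zero)
  have "N \<subseteq> ?L"
  proof (rule least)
    show "?L \<in> stable_subgroups M (carrier R)"
      unfolding stable_subgroups_def
    proof (rule CollectI, intro conjI ballI Ladd)
      fix r x assume r: "r \<in> carrier R" and x: "x \<in> ?L"
      show "r \<odot>\<^bsub>M\<^esub> x \<in> ?L"
      proof (rule smult_closed_if_homogeneous[OF Ladd _ _ r])
        fix n s assume s: "s \<in> Rd n"
        then have "s \<in> carrier R" using R_graded.piece_carrier by blast
        then show "s \<odot>\<^bsub>M\<^esub> x \<in> ?L"
          using x N s by (auto simp: component_smult stable_subgroups_iff)
      qed (use x in auto)
    qed
    show "X \<subseteq> ?L"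
    proof
      fix x assume x: "x \<in> X"
      then obtain i where "x \<in> Md i" using X by blast
      then show "x \<in> ?L"
        using x X Nadd M_graded.piece_carrier
        by (auto simp: M_graded.component_homogeneous additive_subgroup_iff)
    qed
  qed
  then show ?thesis using N by (auto simp: homogeneous_submodule_def)
qed

definition from_degree :: "'m set \<Rightarrow> int \<Rightarrow> 'm set" where
  "from_degree N j = {x \<in> carrier M. \<forall>i<j. part i x \<in> N}"

text \<open>This is \<open>M\<^sub>j + N\<close>, and the quotient by \<open>N\<close> is the degree \<open>j\<close> piece of \<open>M / N\<close>.\<close>
definition in_degree :: "'m set \<Rightarrow> int \<Rightarrow> 'm set" where
  "in_degree N j = {x \<in> carrier M. \<forall>i. i \<noteq> j \<longrightarrow> part i x \<in> N}"

context
  fixes N assumes N: "homogeneous_submodule N"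
begin

lemma homogeneous_stable: "N \<in> stable_subgroups M (carrier R)"
  using N by (simp add: homogeneous_submodule_def)

lemma homogeneous_component_mem: "x \<in> N \<Longrightarrow> part j x \<in> N"
  using N by (simp add: homogeneous_submodule_def)

lemma homogeneous_additive: "subgroup N (add_monoid M)"
  using homogeneous_stable by (simp add: stable_subgroups_def)

lemma homogeneous_closed: "\<zero>\<^bsub>M\<^esub> \<in> N" "x \<in> N \<Longrightarrow> y \<in> N \<Longrightarrow> x \<oplus>\<^bsub>M\<^esub> y \<in> N" "x \<in> N \<Longrightarrow> \<ominus>\<^bsub>M\<^esub> x \<in> N"
  "a \<in> carrier R \<Longrightarrow> x \<in> N \<Longrightarrow> a \<odot>\<^bsub>M\<^esub> x \<in> N" "N \<subseteq> carrier M"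
  using homogeneous_stable by (auto simp: stable_subgroups_iff)

lemma mem_homogeneous_if_components: "x \<in> carrier M \<Longrightarrow> (\<And>j. part j x \<in> N) \<Longrightarrow> x \<in> N"
  using M_graded.mem_subgroup_if_components[OF homogeneous_additive] by blast

lemma from_degree_stable: "from_degree N j \<in> stable_subgroups M (carrier R)"
proof -
  have add: "subgroup (from_degree N j) (add_monoid M)"
    using homogeneous_closed by (auto simp: additive_subgroup_iff from_degree_def M_graded.component_add
        M_graded.component_inv M_graded.component_zero)
  show ?thesis
    unfolding stable_subgroups_def
  proof (rule CollectI, intro conjI ballI add)
    fix r x assume r: "r \<in> carrier R" and x: "x \<in> from_degree N j"
    show "r \<odot>\<^bsub>M\<^esub> x \<in> from_degree N j"
    proof (rule smult_closed_if_homogeneous[OF add _ _ r])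
      fix n s assume s: "s \<in> Rd n"
      then have "s \<in> carrier R" using R_graded.piece_carrier by blast
      then show "s \<odot>\<^bsub>M\<^esub> x \<in> from_degree N j"
        using x homogeneous_closed s by (auto simp: component_smult from_degree_def)
    qed (use x in \<open>auto simp: from_degree_def\<close>)
  qed
qed

lemma in_degree_stable: "in_degree N j \<in> stable_subgroups M (Rd 0)"
  using homogeneous_closed R_graded.piece_carrier[of _ 0]
  by (auto simp: stable_subgroups_iff in_degree_def M_graded.component_add
      M_graded.component_inv M_graded.component_zero component_smult)

lemma homogeneous_subset: "N \<subseteq> from_degree N j" "N \<subseteq> in_degree N j"
  using homogeneous_component_mem homogeneous_closed by (auto simp: from_degree_def in_degree_def)

lemma from_degree_antimono: "i \<le> j \<Longrightarrow> from_degree N j \<subseteq> from_degree N i"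
  by (auto simp: from_degree_def)

lemma minus_component_mem:
  assumes "x \<in> from_degree N j"
  shows "x \<ominus>\<^bsub>M\<^esub> part j x \<in> from_degree N (j + 1)"
  using assms homogeneous_closed
  by (auto simp: from_degree_def M_graded.component_remove)

text \<open>The vector space \<open>(M\<^sub>j + N) / N\<close> and the module \<open>L\<^sub>j / L\<^sub>j\<^sub>+\<^sub>1\<close> given by the filtration are
  isomorphic. Submodules \<open>X\<close> correspond to subspaces \<open>C\<close> by intersecting with \<open>M\<^sub>j + N\<close> in one direction
  and by prescribing the component of degree \<open>j\<close> in the other. That the latter yields a submodule rather
  than just a subspace is the decisive point: a scalar of positive degree moves components of degree
  below \<open>j\<close>, which lie in \<open>N\<close>, into degree \<open>j\<close>.\<close>
lemma graded_piece_length: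
  "relative_length M (carrier R) (from_degree N (j + 1)) (from_degree N j) =
   relative_length M (Rd 0) N (in_degree N j)"
  unfolding relative_length_def
proof (rule chain_height_eq_by_maps[where f = "\<lambda>X. X \<inter> in_degree N j"
      and g = "\<lambda>C. {x \<in> from_degree N j. part j x \<in> C}"])
  fix X assume "X \<in> stable_between M (carrier R) (from_degree N (j + 1)) (from_degree N j)"
  note XD = stable_betweenD[OF this]
  have "Rd 0 \<subseteq> carrier R" by (rule R_graded.piece_subset)
  then have "X \<in> stable_subgroups M (Rd 0)" using stable_subset_scalars XD(1) by blast
  then show "X \<inter> in_degree N j \<in> stable_between M (Rd 0) N (in_degree N j)"
    using homogeneous_subset XD(2) by (intro stable_betweenI stable_Int in_degree_stable) blast+
next
  fix X Y assume X: "X \<in> stable_between M (carrier R) (from_degree N (j + 1)) (from_degree N j)"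
    and Y: "Y \<in> stable_between M (carrier R) (from_degree N (j + 1)) (from_degree N j)"
    and XY: "X \<subset> Y"
  note XD = stable_betweenD[OF X] and YD = stable_betweenD[OF Y]
  obtain y where y: "y \<in> Y" "y \<notin> X" using XY by blast
  let ?z = "part j y"
  have yF: "y \<in> from_degree N j" using y YD by blast
  then have yc: "y \<in> carrier M" by (simp add: from_degree_def)
  have d: "y \<ominus>\<^bsub>M\<^esub> ?z \<in> X" using minus_component_mem[OF yF] XD(2) by blast
  have zc: "?z \<in> carrier M" using yc by simp
  have zX: "?z \<notin> X" using stable_mem_cong[OF XD(1) yc zc d] y by blast
  have zY: "?z \<in> Y" using stable_mem_cong[OF YD(1) yc zc] d XY y by blast
  have "?z \<in> in_degree N j"
    using yc homogeneous_closed by (auto simp: in_degree_def M_graded.component_component)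
  then show "X \<inter> in_degree N j \<subset> Y \<inter> in_degree N j" using zX zY XY by blast
next
  fix C assume "C \<in> stable_between M (Rd 0) N (in_degree N j)"
  note CD = stable_betweenD[OF this]
  let ?X = "{x \<in> from_degree N j. part j x \<in> C}"
  have C1: "\<zero>\<^bsub>M\<^esub> \<in> C" "\<And>x y. x \<in> C \<Longrightarrow> y \<in> C \<Longrightarrow> x \<oplus>\<^bsub>M\<^esub> y \<in> C"
      "\<And>x. x \<in> C \<Longrightarrow> \<ominus>\<^bsub>M\<^esub> x \<in> C" "\<And>a x. a \<in> Rd 0 \<Longrightarrow> x \<in> C \<Longrightarrow> a \<odot>\<^bsub>M\<^esub> x \<in> C"
    using CD(1) by (auto simp: stable_subgroups_iff)
  have F: "from_degree N j \<subseteq> carrier M" by (auto simp: from_degree_def)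
  have add: "subgroup ?X (add_monoid M)"
    using from_degree_stable[of j] C1 F
    by (auto simp: additive_subgroup_iff stable_subgroups_iff M_graded.component_add
        M_graded.component_inv M_graded.component_zero subset_iff)
  show "?X \<in> stable_between M (carrier R) (from_degree N (j + 1)) (from_degree N j)"
  proof (rule stable_betweenI)
    show "?X \<in> stable_subgroups M (carrier R)"
      unfolding stable_subgroups_def
    proof (rule CollectI, intro conjI ballI add)
      fix r x assume r: "r \<in> carrier R" and x: "x \<in> ?X"
      show "r \<odot>\<^bsub>M\<^esub> x \<in> ?X"
      proof (rule smult_closed_if_homogeneous[OF add _ _ r])
        fix n s assume s: "s \<in> Rd n"
        then have sc: "s \<in> carrier R" using R_graded.piece_carrier by blast
        have 1: "s \<odot>\<^bsub>M\<^esub> x \<in> from_degree N j"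
          using from_degree_stable[of j] sc x by (auto simp: stable_subgroups_iff)
        have "s \<odot>\<^bsub>M\<^esub> part (j - int n) x \<in> C"
        proof (cases "n = 0")
          case True
          then show ?thesis using s x C1(4) by simp
        next
          case False
          then have "part (j - int n) x \<in> N" using x by (auto simp: from_degree_def)
          then show ?thesis using homogeneous_closed(4)[OF sc] CD(2) by blast
        qed
        then show "s \<odot>\<^bsub>M\<^esub> x \<in> ?X" using 1 x s F by (auto simp: component_smult subset_iff)
      qed (use x F in auto)
    qed
    show "from_degree N (j + 1) \<subseteq> ?X" using CD(2) by (auto simp: from_degree_def)
  qed auto
next
  fix C E assume C: "C \<in> stable_between M (Rd 0) N (in_degree N j)"
    and E: "E \<in> stable_between M (Rd 0) N (in_degree N j)" and CE: "C \<subset> E"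
  note CD = stable_betweenD[OF C] and ED = stable_betweenD[OF E]
  obtain e where e: "e \<in> E" "e \<notin> C" using CE by blast
  let ?z = "part j e"
  have eU: "e \<in> in_degree N j" using e ED by blast
  then have ec: "e \<in> carrier M" by (simp add: in_degree_def)
  have d: "e \<ominus>\<^bsub>M\<^esub> ?z \<in> N"
  proof (rule mem_homogeneous_if_components)
    fix i show "part i (e \<ominus>\<^bsub>M\<^esub> ?z) \<in> N"
      using ec eU homogeneous_closed
      by (auto simp: M_graded.component_remove in_degree_def)
  qed (use ec in simp)
  have zc: "?z \<in> carrier M" using ec by simp
  have zE: "?z \<in> E" using stable_mem_cong[OF ED(1) ec zc] d e ED(2) by blast
  have zC: "?z \<notin> C" using stable_mem_cong[OF CD(1) ec zc] d e CD(2) by blast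
  have "?z \<in> from_degree N j"
    using ec homogeneous_closed by (auto simp: from_degree_def M_graded.component_component)
  moreover have "part j ?z = ?z" using ec by (simp add: M_graded.component_component)
  ultimately have "?z \<in> {x \<in> from_degree N j. part j x \<in> E}"
    "?z \<notin> {x \<in> from_degree N j. part j x \<in> C}"
    using zC zE by auto
  then show "{x \<in> from_degree N j. part j x \<in> C} \<subset> {x \<in> from_degree N j. part j x \<in> E}"
    using CE by blast
qed

end

end

lemma the_enat_sum:
  assumes "finite F" "(\<Sum>j\<in>F. f j) \<noteq> (\<infinity>::enat)"
  shows "the_enat (\<Sum>j\<in>F. f j) = (\<Sum>j\<in>F. the_enat (f j))"
  using assms
proof (induction F rule: finite_induct)
  case (insert x F)
  then have "f x + (\<Sum>j\<in>F. f j) \<noteq> \<infinity>" by simp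
  then obtain a b where "f x = enat a" "(\<Sum>j\<in>F. f j) = enat b"
    by (metis enat.exhaust plus_eq_infty_iff_enat)
  then show ?case using insert by simp
qed (simp add: zero_enat_def)

context module_over_graded_ring
begin

context
  fixes N assumes N: "homogeneous_submodule N"
begin

text \<open>Each degree in which \<open>M\<close> is not contained in \<open>N\<close> contributes a strict step to the filtration, and
  a module of finite length has no room for infinitely many of them.\<close>
lemma eventually_piece_subset:
  assumes fin: "relative_length M (carrier R) N (carrier M) \<noteq> \<infinity>"
  shows "\<exists>b. \<forall>j\<ge>b. Md j \<subseteq> N"
proof (rule ccontr)
  assume "\<nexists>b. \<forall>j\<ge>b. Md j \<subseteq> N"
  then have unbounded: "\<exists>j\<ge>b. \<not> Md j \<subseteq> N" for b by blast
  have mem: "from_degree N b \<in> stable_between M (carrier R) N (carrier M)" for b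
    using from_degree_stable[OF N] homogeneous_subset[OF N] by (intro stable_betweenI) (auto simp: from_degree_def)
  have chain: "chain_to (stable_between M (carrier R) N (carrier M)) n (from_degree N b)" for n b
  proof (induction n arbitrary: b)
    case 0
    show ?case using mem by simp
  next
    case (Suc n)
    obtain j m where j: "j \<ge> b" "m \<in> Md j" "m \<notin> N" using unbounded[of b] by blast
    then have "m \<in> from_degree N j" "m \<notin> from_degree N (j + 1)"
      using homogeneous_closed(1)[OF N] M_graded.piece_carrier
      by (auto simp: from_degree_def M_graded.component_homogeneous)
    then have "from_degree N (j + 1) \<subset> from_degree N b"
      using from_degree_antimono[OF N, of b j] from_degree_antimono[OF N, of j "j + 1"] j by auto
    then show ?case unfolding chain_to.simps using Suc mem by blast
  qed
  have "enat n \<le> relative_length M (carrier R) N (carrier M)" for n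
    unfolding relative_length_def by (rule chain_height_upper[OF chain])
  moreover obtain l where "relative_length M (carrier R) N (carrier M) = enat l" using fin by auto
  ultimately have "enat (Suc l) \<le> enat l" by metis
  then show False by simp
qed

text \<open>Telescoping along the filtration.\<close>
lemma relative_length_filtration:
  assumes "a \<le> b"
  shows "relative_length M (carrier R) (from_degree N b) (from_degree N a) =
    (\<Sum>j\<in>{a..<b}. relative_length M (Rd 0) N (in_degree N j))"
  using assms
proof (induction b rule: int_ge_induct)
  case base
  show ?case by (simp add: relative_length_self)
next
  case (step b)
  have "relative_length M (carrier R) (from_degree N (b + 1)) (from_degree N a) =
      relative_length M (carrier R) (from_degree N (b + 1)) (from_degree N b) +
      relative_length M (carrier R) (from_degree N b) (from_degree N a)"
    using step.hyps
    by (intro relative_length_additive from_degree_stable[OF N] from_degree_antimono[OF N]) auto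
  moreover have "{a..<b + 1} = insert b {a..<b}" using step.hyps by auto
  ultimately show ?case using step.IH by (simp add: graded_piece_length[OF N])
qed

lemma in_degree_eq:
  assumes "\<And>x. x \<in> carrier M \<Longrightarrow> part j x \<in> N"
  shows "in_degree N j = N"
proof (rule antisym)
  show "in_degree N j \<subseteq> N"
  proof
    fix x assume x: "x \<in> in_degree N j"
    show "x \<in> N"
    proof (rule mem_homogeneous_if_components[OF N])
      show "part i x \<in> N" for i using assms x by (cases "i = j") (auto simp: in_degree_def)
    qed (use x in \<open>simp add: in_degree_def\<close>)
  qed
qed (rule homogeneous_subset[OF N])

lemma relative_length_eq_sum:
  assumes low: "\<And>x i. x \<in> carrier M \<Longrightarrow> i < a \<Longrightarrow> part i x \<in> N"
    and high: "\<And>j. j \<ge> b \<Longrightarrow> Md j \<subseteq> N" and ab: "a \<le> b"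
  shows "relative_length M (carrier R) N (carrier M) =
      (\<Sum>j\<in>{a..<b}. relative_length M (Rd 0) N (in_degree N j))"
    and "j \<notin> {a..<b} \<Longrightarrow> relative_length M (Rd 0) N (in_degree N j) = 0"
proof -
  have high': "part j x \<in> N" if "b \<le> j" "x \<in> carrier M" for j x
    using high[OF that(1)] M_graded.component_mem[OF that(2)] by blast
  have "from_degree N a = carrier M" using low by (auto simp: from_degree_def)
  moreover have "from_degree N b \<subseteq> N"
  proof
    fix x assume x: "x \<in> from_degree N b"
    show "x \<in> N"
    proof (rule mem_homogeneous_if_components[OF N])
      show "part j x \<in> N" for j using x high'[of j x] by (cases "j < b") (auto simp: from_degree_def)
    qed (use x in \<open>simp add: from_degree_def\<close>)
  qed
  then have "from_degree N b = N" using homogeneous_subset(1)[OF N] by blast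
  ultimately show "relative_length M (carrier R) N (carrier M) =
      (\<Sum>j\<in>{a..<b}. relative_length M (Rd 0) N (in_degree N j))"
    using relative_length_filtration[OF ab] by simp
  show "relative_length M (Rd 0) N (in_degree N j) = 0" if "j \<notin> {a..<b}"
  proof -
    have "in_degree N j = N" using that low high' by (intro in_degree_eq) auto
    then show ?thesis by (simp add: relative_length_self)
  qed
qed

text \<open>The algebra \<open>A\<close> is the ring \<open>R\<close> with its scalar multiplication by \<open>K\<close>, whose structure
  map sends \<open>K\<close> onto the degree zero piece.\<close>
lemma quotient_piece_length:
  assumes K: "(\<lambda>c. c \<odot>\<^bsub>A\<^esub> \<one>\<^bsub>A\<^esub>) ` carrier K = Rd 0"
  shows "module_length K (quotient_piece A M Md N j) = relative_length M (Rd 0) N (in_degree N j)"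
proof (rule module_length_eq_relative_length[where \<phi> = "\<lambda>c. c \<odot>\<^bsub>A\<^esub> \<one>\<^bsub>A\<^esub>"])
  have R0: "Rd 0 \<subseteq> carrier R" by (rule R_graded.piece_subset)
  have NR: "N \<in> stable_subgroups M (carrier R)" by (rule homogeneous_stable[OF N])
  show "N \<in> stable_subgroups M (Rd 0)" using NR stable_subset_scalars[OF R0] by blast
  show "in_degree N j \<in> stable_subgroups M (Rd 0)" by (rule in_degree_stable[OF N])
  show "N \<subseteq> in_degree N j" by (rule homogeneous_subset[OF N])
  show "Rd 0 = (\<lambda>c. c \<odot>\<^bsub>A\<^esub> \<one>\<^bsub>A\<^esub>) ` carrier K" using K by simp
  show "carrier (quotient_piece A M Md N j) = (\<lambda>m. N +>\<^bsub>M\<^esub> m) ` in_degree N j"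
  proof -
    have "N +>\<^bsub>M\<^esub> x \<in> (\<lambda>m. N +>\<^bsub>M\<^esub> m) ` Md j" if x: "x \<in> in_degree N j" for x
    proof -
      have xc: "x \<in> carrier M" using x by (simp add: in_degree_def)
      have "x \<ominus>\<^bsub>M\<^esub> part j x \<in> N"
      proof (rule mem_homogeneous_if_components[OF N])
        show "part i (x \<ominus>\<^bsub>M\<^esub> part j x) \<in> N" for i
          using x xc homogeneous_closed(1)[OF N] by (auto simp: M_graded.component_remove in_degree_def)
      qed (use xc in simp)
      then have "N +>\<^bsub>M\<^esub> x = N +>\<^bsub>M\<^esub> part j x" using coset_eq_iff[OF NR] xc by simp
      then show ?thesis using M_graded.component_mem[OF xc] by blast
    qed
    moreover have "Md j \<subseteq> in_degree N j"
      using homogeneous_closed(1)[OF N] M_graded.piece_carrier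
      by (auto simp: in_degree_def M_graded.component_homogeneous)
    ultimately show ?thesis by (auto simp: quotient_piece_def)
  qed
  show "c \<odot>\<^bsub>quotient_piece A M Md N j\<^esub> (N +>\<^bsub>M\<^esub> m) = N +>\<^bsub>M\<^esub> (c \<odot>\<^bsub>A\<^esub> \<one>\<^bsub>A\<^esub> \<odot>\<^bsub>M\<^esub> m)"
    if "c \<in> carrier K" "m \<in> in_degree N j" for c m
  proof -
    have "c \<odot>\<^bsub>A\<^esub> \<one>\<^bsub>A\<^esub> \<in> carrier R" using K R0 that by blast
    then show ?thesis
      using quotient_module_smult[OF NR] that by (simp add: quotient_piece_def in_degree_def)
  qed
qed (simp_all add: quotient_piece_def quotient_module_def)

lemma length_eq_graded_length:
  assumes K: "(\<lambda>c. c \<odot>\<^bsub>A\<^esub> \<one>\<^bsub>A\<^esub>) ` carrier K = Rd 0"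
    and fin: "relative_length M (carrier R) N (carrier M) \<noteq> \<infinity>"
    and low: "\<And>x i. x \<in> carrier M \<Longrightarrow> i < a \<Longrightarrow> part i x \<in> N"
  shows "of_nat (the_enat (module_length R (quotient_module M N))) =
    (\<Sum>\<^sub>\<infinity>j\<in>UNIV. complex_of_nat (the_enat (module_length K (quotient_piece A M Md N j))))"
proof -
  obtain b where b: "\<And>j. j \<ge> b \<Longrightarrow> Md j \<subseteq> N" using eventually_piece_subset[OF fin] by blast
  \<comment> \<open>Nothing prevents \<open>b\<close> from lying below \<open>a\<close>, for instance if \<open>N\<close> is all of \<open>M\<close>.\<close>
  let ?b = "max a b" and ?l = "\<lambda>j. relative_length M (Rd 0) N (in_degree N j)"
  have high: "Md j \<subseteq> N" if "j \<ge> ?b" for j using b that by simp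
  have sum: "relative_length M (carrier R) N (carrier M) = (\<Sum>j\<in>{a..<?b}. ?l j)"
    by (rule relative_length_eq_sum(1)[OF low high]) auto
  have zero: "?l j = 0" if "j \<notin> {a..<?b}" for j
    by (rule relative_length_eq_sum(2)[OF low high _ that]) auto
  have "(\<Sum>\<^sub>\<infinity>j\<in>UNIV. complex_of_nat (the_enat (?l j))) =
      (\<Sum>\<^sub>\<infinity>j\<in>{a..<?b}. complex_of_nat (the_enat (?l j)))"
    by (rule infsum_cong_neutral) (use zero in \<open>auto simp: zero_enat_def\<close>)
  also have "\<dots> = (\<Sum>j\<in>{a..<?b}. complex_of_nat (the_enat (?l j)))" by simp
  also have "\<dots> = of_nat (the_enat (\<Sum>j\<in>{a..<?b}. ?l j))"
    using the_enat_sum[of "{a..<?b}" ?l] fin sum by simp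
  finally show ?thesis
    using sum by (simp add: quotient_piece_length[OF K] module_length_quotient_module[OF homogeneous_stable[OF N]])
qed

end

end

text \<open>Scalars have nonnegative degrees, so no degree lies below those of the finitely many generators.\<close>
lemma (in module_over_graded_ring) degrees_bounded_below:
  assumes N: "homogeneous_submodule N" and fg: "fin_gen_module R M"
  shows "\<exists>a. \<forall>x\<in>carrier M. \<forall>i<a. part i x \<in> N"
proof -
  obtain G where G: "finite G" "G \<subseteq> carrier M" "module_span R M G = carrier M"
    using fg by (auto simp: fin_gen_module_def)
  let ?D = "\<Union>g\<in>G. {i. part i g \<noteq> \<zero>\<^bsub>M\<^esub>}"
  have "finite ?D" using G M_graded.finite_support by auto
  then obtain a where a: "\<And>i. i \<in> ?D \<Longrightarrow> a \<le> i" using bdd_below_finite[of ?D] by (auto simp: bdd_below_def)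
  have "part i g \<in> N" if "g \<in> G" "i < a" for g i
  proof -
    have "part i g = \<zero>\<^bsub>M\<^esub>" using a[of i] that by fastforce
    then show ?thesis using homogeneous_closed(1)[OF N] by simp
  qed
  then have "G \<subseteq> from_degree N a" using G(2) by (auto simp: from_degree_def)
  then have "carrier M \<subseteq> from_degree N a"
    using span_least[OF from_degree_stable[OF N]] G(3) by metis
  then show ?thesis by (auto simp: from_degree_def)
qed

section \<open>Monomials\<close>

context cring
begin

definition monomial :: "'a set \<Rightarrow> ('a \<Rightarrow> nat) \<Rightarrow> 'a" where
  "monomial T e = (\<Otimes>t\<in>T. t [^] e t)"

lemma monomial_closed [simp, intro]: "T \<subseteq> carrier R \<Longrightarrow> monomial T e \<in> carrier R"
  unfolding monomial_def by (intro finprod_closed) auto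

lemma monomial_mult:
  assumes "T \<subseteq> carrier R"
  shows "monomial T e \<otimes> monomial T f = monomial T (\<lambda>t. e t + f t)"
proof -
  have "(\<Otimes>t\<in>T. t [^] e t \<otimes> t [^] f t) = monomial T e \<otimes> monomial T f"
    unfolding monomial_def by (rule finprod_multf) (use assms in auto)
  moreover have "(\<Otimes>t\<in>T. t [^] e t \<otimes> t [^] f t) = monomial T (\<lambda>t. e t + f t)"
    unfolding monomial_def by (rule finprod_cong') (use assms in \<open>auto simp: nat_pow_mult\<close>)
  ultimately show ?thesis by simp
qed

lemma monomial_zero: "T \<subseteq> carrier R \<Longrightarrow> monomial T (\<lambda>t. 0) = \<one>"
  unfolding monomial_def by simp

lemma monomial_generator:
  assumes "finite T" "T \<subseteq> carrier R" "t \<in> T"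
  shows "monomial T (\<lambda>s. if t = s then 1 else 0) = t"
proof -
  have "monomial T (\<lambda>s. if t = s then 1 else 0) = (\<Otimes>s\<in>T. if t = s then s else \<one>)"
    unfolding monomial_def using assms by (intro finprod_cong') auto
  also have "\<dots> = t" using finprod_singleton[OF assms(3,1), of "\<lambda>s. s"] assms(2) by auto
  finally show ?thesis .
qed

lemma monomial_factor:
  assumes "finite T" "T \<subseteq> carrier R" "t \<in> T" "n \<le> e t"
  shows "\<exists>r\<in>carrier R. monomial T e = r \<otimes> t [^] n"
proof -
  let ?r = "monomial (T - {t}) e"
  have t: "t \<in> carrier R" and r: "?r \<in> carrier R" using assms by auto
  have "monomial T e = monomial (insert t (T - {t})) e" using assms(3) by (simp add: insert_absorb)
  also have "\<dots> = t [^] e t \<otimes> ?r"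
    unfolding monomial_def using assms by (intro finprod_insert) auto
  also have "t [^] e t = t [^] (e t - n) \<otimes> t [^] n" using t assms(4) by (simp add: nat_pow_mult)
  also have "t [^] (e t - n) \<otimes> t [^] n \<otimes> ?r = (?r \<otimes> t [^] (e t - n)) \<otimes> t [^] n"
    using t r by (simp add: m_ac)
  finally show ?thesis using t r by blast
qed

definition bounded_monomials :: "'a set \<Rightarrow> nat \<Rightarrow> 'a set" where
  "bounded_monomials T n = {monomial T e | e. \<forall>t\<in>T. e t < n}"

lemma finite_bounded_monomials:
  assumes "finite T" "T \<subseteq> carrier R"
  shows "finite (bounded_monomials T n)"
proof -
  have "bounded_monomials T n \<subseteq> monomial T ` (T \<rightarrow>\<^sub>E {..<n})"
  proof
    fix x assume "x \<in> bounded_monomials T n"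
    then obtain e where e: "x = monomial T e" "\<forall>t\<in>T. e t < n" by (auto simp: bounded_monomials_def)
    have "monomial T e = monomial T (restrict e T)"
      unfolding monomial_def using assms(2) by (intro finprod_cong') auto
    moreover have "restrict e T \<in> T \<rightarrow>\<^sub>E {..<n}" using e(2) by auto
    ultimately show "x \<in> monomial T ` (T \<rightarrow>\<^sub>E {..<n})" using e(1) by blast
  qed
  then show ?thesis using finite_PiE[OF assms(1), of "\<lambda>_. {..<n}"] finite_subset by blast
qed

text \<open>For a subring \<open>Z\<close> this is a \<open>Z\<close>-submodule of \<open>R\<close>.\<close>
definition stable_additive :: "'a set \<Rightarrow> 'a set \<Rightarrow> bool" where
  "stable_additive Z H \<longleftrightarrow> subgroup H (add_monoid R) \<and> (\<forall>z\<in>Z. \<forall>h\<in>H. z \<otimes> h \<in> H)"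

lemma stable_additive_quotient:
  assumes H: "stable_additive Z H" and Z: "Z \<subseteq> carrier R" and y: "y \<in> carrier R"
  shows "stable_additive Z {x \<in> carrier R. x \<otimes> y \<in> H}"
  using assms
  by (auto simp: stable_additive_def additive_subgroup_iff l_distr l_minus m_assoc subset_iff)

text \<open>An algebra over \<open>Z\<close> is spanned over \<open>Z\<close> by the monomials in its generators: their span \<open>W\<close> contains
  \<open>Z\<close> and the generators, and it is closed under products because the monomials are.\<close>
lemma carrier_subset_if_monomials:
  assumes Z: "Z \<subseteq> carrier R" and T: "finite T" "T \<subseteq> carrier R"
    and gen: "generate_ring R (Z \<union> T) = carrier R"
    and H: "stable_additive Z H" and mon: "\<And>e. monomial T e \<in> H"
  shows "carrier R \<subseteq> H"
proof -
  define W where "W = \<Inter>{H. stable_additive Z H \<and> (\<forall>e. monomial T e \<in> H)}"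
  have least: "W \<subseteq> L" if "stable_additive Z L" "\<And>e. monomial T e \<in> L" for L
    using that by (auto simp: W_def)
  have WH: "W \<subseteq> H" using H mon by (rule least)
  then have Wc: "W \<subseteq> carrier R" using H by (auto simp: stable_additive_def additive_subgroup_iff)
  have Wmon: "monomial T e \<in> W" for e by (auto simp: W_def)
  have Wst: "stable_additive Z W"
    using Wc by (auto simp: W_def stable_additive_def additive_subgroup_iff)
  have W1: "\<one> \<in> W" using Wmon monomial_zero[OF T(2)] by metis
  have 1: "x \<otimes> monomial T e \<in> W" if x: "x \<in> W" for x e
  proof -
    have "W \<subseteq> {x \<in> carrier R. x \<otimes> monomial T e \<in> W}"
      using Wmon T(2) monomial_mult[OF T(2)]
      by (intro least stable_additive_quotient[OF Wst Z]) auto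
    then show ?thesis using x by blast
  qed
  have mult: "x \<otimes> y \<in> W" if xy: "x \<in> W" "y \<in> W" for x y
  proof -
    have xc: "x \<in> carrier R" using xy Wc by blast
    have "W \<subseteq> {y \<in> carrier R. y \<otimes> x \<in> W}"
      using 1[OF xy(1)] xc T(2) m_comm
      by (intro least stable_additive_quotient[OF Wst Z]) (auto simp: m_comm)
    then have "y \<in> carrier R" "y \<otimes> x \<in> W" using xy by auto
    then show ?thesis using xc m_comm[of x y] by simp
  qed
  have "x \<in> W" if "x \<in> generate_ring R (Z \<union> T)" for x
    using that
  proof (induction rule: generate_ring.induct)
    case one
    show ?case by (rule W1)
  next
    case (incl h)
    then show ?case
    proof
      assume h: "h \<in> Z"
      then have "h \<otimes> \<one> \<in> W" using Wst W1 by (auto simp: stable_additive_def)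
      then show ?thesis using h Z by (auto simp: subset_iff)
    next
      assume "h \<in> T"
      then show ?thesis using monomial_generator[OF T] Wmon by metis
    qed
  next
    case (a_inv h)
    then show ?case using Wst by (auto simp: stable_additive_def additive_subgroup_iff)
  next
    case (eng_add h1 h2)
    then show ?case using Wst by (auto simp: stable_additive_def additive_subgroup_iff)
  next
    case (eng_mult h1 h2)
    then show ?case using mult by blast
  qed
  then show ?thesis using gen WH by blast
qed

end

section \<open>Finiteness of length\<close>

context module
begin

text \<open>If the scalars form a field, then adjoining one vector raises the dimension by at most one: any
  larger subspace contains \<open>c f\<close> for some \<open>c \<noteq> 0\<close> and hence \<open>f\<close>.\<close>
lemma relative_length_adjoin:
  assumes S: "subgroup S (add_monoid R)" "\<And>a b. a \<in> S \<Longrightarrow> b \<in> S \<Longrightarrow> a \<otimes> b \<in> S" "\<one> \<in> S"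
    and division: "\<And>c. c \<in> S \<Longrightarrow> c \<noteq> \<zero> \<Longrightarrow> \<exists>d\<in>S. d \<otimes> c = \<one>"
    and V: "V \<in> stable_subgroups M S" and f: "f \<in> carrier M"
  shows "\<exists>W\<in>stable_subgroups M S. V \<subseteq> W \<and> f \<in> W \<and> relative_length M S V W \<le> 1"
proof -
  have Sc: "S \<subseteq> carrier R" using S by (simp add: additive_subgroup_iff)
  let ?L = "{c \<odot>\<^bsub>M\<^esub> f | c. c \<in> S}"
  have L: "?L \<in> stable_subgroups M S"
    unfolding stable_subgroups_iff
  proof (intro conjI ballI)
    show "?L \<subseteq> carrier M" using Sc f by auto
    have "\<zero> \<in> S" using S(1) by (simp add: additive_subgroup_iff)
    moreover have "\<zero>\<^bsub>M\<^esub> = \<zero> \<odot>\<^bsub>M\<^esub> f" using f by simp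
    ultimately show "\<zero>\<^bsub>M\<^esub> \<in> ?L" by blast
  next
    fix x y assume "x \<in> ?L" "y \<in> ?L"
    then obtain c d where cd: "c \<in> S" "d \<in> S" "x = c \<odot>\<^bsub>M\<^esub> f" "y = d \<odot>\<^bsub>M\<^esub> f" by blast
    then have "x \<oplus>\<^bsub>M\<^esub> y = (c \<oplus> d) \<odot>\<^bsub>M\<^esub> f" using Sc f by (simp add: smult_l_distr subset_iff)
    moreover have "c \<oplus> d \<in> S" using cd S(1) by (simp add: additive_subgroup_iff)
    ultimately show "x \<oplus>\<^bsub>M\<^esub> y \<in> ?L" by blast
  next
    fix x assume "x \<in> ?L"
    then obtain c where c: "c \<in> S" "x = c \<odot>\<^bsub>M\<^esub> f" by blast
    then have "\<ominus>\<^bsub>M\<^esub> x = (\<ominus> c) \<odot>\<^bsub>M\<^esub> f" using Sc f by (simp add: smult_l_minus subset_iff)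
    moreover have "\<ominus> c \<in> S" using c S(1) by (simp add: additive_subgroup_iff)
    ultimately show "\<ominus>\<^bsub>M\<^esub> x \<in> ?L" by blast
  next
    fix a x assume a: "a \<in> S" and "x \<in> ?L"
    then obtain c where c: "c \<in> S" "x = c \<odot>\<^bsub>M\<^esub> f" by blast
    then have "a \<odot>\<^bsub>M\<^esub> x = (a \<otimes> c) \<odot>\<^bsub>M\<^esub> f" using Sc f a by (simp add: smult_assoc1 subset_iff)
    then show "a \<odot>\<^bsub>M\<^esub> x \<in> ?L" using S(2)[OF a c(1)] by blast
  qed
  let ?W = "V <+>\<^bsub>M\<^esub> ?L"
  have W: "?W \<in> stable_subgroups M S" using stable_sum[OF V L Sc] .
  have "f = \<one> \<odot>\<^bsub>M\<^esub> f" using f by simp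
  then have fL: "f \<in> ?L" using S(3) by blast
  have VW: "V \<subseteq> ?W" and fW: "f \<in> ?W" using sum_upper[OF V L] fL by auto
  have Vc: "V \<subseteq> carrier M" using V by (simp add: stable_subgroups_iff)
  have full: "Y = ?W" if Y: "Y \<in> stable_between M S V ?W" and ne: "Y \<noteq> V" for Y
  proof -
    note YD = stable_betweenD[OF Y]
    obtain y where y: "y \<in> Y" "y \<notin> V" using ne YD(2) by blast
    then have "y \<in> ?W" using YD(3) by blast
    then obtain v c where v: "v \<in> V" "c \<in> S" "y = v \<oplus>\<^bsub>M\<^esub> c \<odot>\<^bsub>M\<^esub> f"
      unfolding set_add_def' by blast
    have cc: "c \<in> carrier R" "v \<in> carrier M" using v Sc Vc by auto
    have "c \<noteq> \<zero>" using v y Vc f by auto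
    then obtain d where d: "d \<in> S" "d \<otimes> c = \<one>" using division v by blast
    have "y \<ominus>\<^bsub>M\<^esub> v = c \<odot>\<^bsub>M\<^esub> f" using v cc f by (simp add: M.add_minus_cancel)
    then have "c \<odot>\<^bsub>M\<^esub> f \<in> Y" using stable_minus[OF YD(1) y(1), of v] v YD(2) by auto
    then have "d \<odot>\<^bsub>M\<^esub> (c \<odot>\<^bsub>M\<^esub> f) \<in> Y" using YD(1) d by (simp add: stable_subgroups_iff)
    moreover have "d \<odot>\<^bsub>M\<^esub> (c \<odot>\<^bsub>M\<^esub> f) = f"
      using d cc Sc f by (simp add: smult_assoc1[symmetric] subset_iff)
    ultimately have "f \<in> Y" by simp
    then have "?L \<subseteq> Y" using YD(1) by (auto simp: stable_subgroups_iff)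
    then have "?W \<subseteq> Y" using sum_least[OF YD(1,2)] by blast
    then show ?thesis using YD(3) by blast
  qed
  have "relative_length M S V ?W \<le> 1"
    unfolding relative_length_def
  proof (rule chain_height_least)
    fix n X assume X: "chain_to (stable_between M S V ?W) n X"
    have "n \<le> 1"
    proof (rule ccontr)
      assume "\<not> n \<le> 1"
      then obtain k where k: "n = Suc (Suc k)" by (metis One_nat_def le_add1 not_less_eq_eq plus_1_eq_Suc less_imp_Suc_add not_le)
      obtain Y where Y: "Y \<subset> X" "chain_to (stable_between M S V ?W) (Suc k) Y"
        "X \<in> stable_between M S V ?W"
        using X unfolding k chain_to.simps(2)[of _ "Suc k"] by blast
      then obtain Z where Z: "Z \<subset> Y" "chain_to (stable_between M S V ?W) k Z"
        "Y \<in> stable_between M S V ?W"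
        unfolding chain_to.simps by blast
      have "Z \<in> stable_between M S V ?W" using Z(2) by (rule chain_to_mem)
      then have "Y = ?W" using full[OF Z(3)] Z(1) by (auto simp: stable_between_def)
      then show False using Y(1,3) by (auto simp: stable_between_def)
    qed
    then show "enat n \<le> 1" by (simp add: one_enat_def)
  qed
  then show ?thesis using W VW fW by blast
qed

lemma relative_length_adjoin_finite:
  assumes S: "subgroup S (add_monoid R)" "\<And>a b. a \<in> S \<Longrightarrow> b \<in> S \<Longrightarrow> a \<otimes> b \<in> S" "\<one> \<in> S"
    and division: "\<And>c. c \<in> S \<Longrightarrow> c \<noteq> \<zero> \<Longrightarrow> \<exists>d\<in>S. d \<otimes> c = \<one>"
    and V: "V \<in> stable_subgroups M S" and F: "finite F" "F \<subseteq> carrier M"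
  shows "\<exists>W\<in>stable_subgroups M S. V \<subseteq> W \<and> F \<subseteq> W \<and> relative_length M S V W \<noteq> \<infinity>"
  using F
proof (induction F rule: finite_induct)
  case empty
  show ?case using V relative_length_self[of S V] by (intro bexI[of _ V]) auto
next
  case (insert f F)
  have Sc: "S \<subseteq> carrier R" using S by (simp add: additive_subgroup_iff)
  obtain W where W: "W \<in> stable_subgroups M S" "V \<subseteq> W" "F \<subseteq> W" "relative_length M S V W \<noteq> \<infinity>"
    using insert by blast
  have "f \<in> carrier M" using insert by simp
  from relative_length_adjoin[OF S division W(1) this]
  obtain W' where W': "W' \<in> stable_subgroups M S" "W \<subseteq> W'" "f \<in> W'" "relative_length M S W W' \<le> 1"
    by blast
  have "relative_length M S V W' = relative_length M S V W + relative_length M S W W'"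
    by (rule relative_length_additive[OF V W(1) W'(1) W(2) W'(2) Sc])
  moreover have "relative_length M S W W' \<noteq> \<infinity>" using W'(4) by (intro notI) (simp add: one_enat_def)
  ultimately have "relative_length M S V W' \<noteq> \<infinity>" using W(4) by (simp add: plus_eq_infty_iff_enat)
  then show ?case using W W' by (intro bexI[of _ W']) auto
qed

text \<open>Here \<open>R\<close> is an algebra over the field \<open>S\<close>, and the \<open>n\<close>-th powers of its generators kill \<open>M / N\<close>.
  Modulo \<open>N\<close> only the finitely many monomials with all exponents below \<open>n\<close> matter, so \<open>M / N\<close> has finite
  dimension over \<open>S\<close>, and a chain of \<open>R\<close>-submodules is in particular a chain of subspaces.\<close>
lemma finite_length_if_nilpotent_generators:
  assumes S: "subgroup S (add_monoid R)" "\<And>a b. a \<in> S \<Longrightarrow> b \<in> S \<Longrightarrow> a \<otimes> b \<in> S" "\<one> \<in> S"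
    and division: "\<And>c. c \<in> S \<Longrightarrow> c \<noteq> \<zero> \<Longrightarrow> \<exists>d\<in>S. d \<otimes> c = \<one>"
    and T: "finite T" "T \<subseteq> carrier R" and gen: "generate_ring R (S \<union> T) = carrier R"
    and fg: "fin_gen_module R M"
    and N: "N \<in> stable_subgroups M (carrier R)"
    and pow: "\<And>t x. t \<in> T \<Longrightarrow> x \<in> carrier M \<Longrightarrow> t [^] (n::nat) \<odot>\<^bsub>M\<^esub> x \<in> N"
  shows "relative_length M (carrier R) N (carrier M) \<noteq> \<infinity>"
proof -
  have Sc: "S \<subseteq> carrier R" using S by (simp add: additive_subgroup_iff)
  have NS: "N \<in> stable_subgroups M S" using N stable_subset_scalars[OF Sc] by blast
  obtain G where G: "finite G" "G \<subseteq> carrier M" "module_span R M G = carrier M"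
    using fg by (auto simp: fin_gen_module_def)
  let ?F = "(\<lambda>(r, g). r \<odot>\<^bsub>M\<^esub> g) ` (bounded_monomials T n \<times> G)"
  have "bounded_monomials T n \<subseteq> carrier R" using T by (auto simp: bounded_monomials_def)
  then have F: "finite ?F" "?F \<subseteq> carrier M"
    using finite_bounded_monomials[OF T] G by auto
  obtain W where W: "W \<in> stable_subgroups M S" "N \<subseteq> W" "?F \<subseteq> W" "relative_length M S N W \<noteq> \<infinity>"
    using relative_length_adjoin_finite[OF S division NS F] by blast
  have Wc: "W \<subseteq> carrier M" using W by (simp add: stable_subgroups_iff)
  have mon: "monomial T e \<odot>\<^bsub>M\<^esub> g \<in> W" if g: "g \<in> G" for e g
  proof (cases "\<forall>t\<in>T. e t < n")
    case True
    then have "monomial T e \<in> bounded_monomials T n" by (auto simp: bounded_monomials_def)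
    then show ?thesis using W(3) g by auto
  next
    case False
    then obtain t where t: "t \<in> T" "n \<le> e t" by (auto simp: not_less)
    obtain r where r: "r \<in> carrier R" "monomial T e = r \<otimes> t [^] n"
      using monomial_factor[OF T t(1), of n e] t(2) by blast
    have "t [^] n \<in> carrier R" "g \<in> carrier M" using t T G g by auto
    then have "monomial T e \<odot>\<^bsub>M\<^esub> g = r \<odot>\<^bsub>M\<^esub> (t [^] n \<odot>\<^bsub>M\<^esub> g)"
      using r by (simp add: smult_assoc1)
    moreover have "r \<odot>\<^bsub>M\<^esub> (t [^] n \<odot>\<^bsub>M\<^esub> g) \<in> N"
      using N r pow[OF t(1) \<open>g \<in> carrier M\<close>] by (simp add: stable_subgroups_iff)
    ultimately show ?thesis using W(2) by auto
  qed
  have all: "r \<odot>\<^bsub>M\<^esub> g \<in> W" if g: "g \<in> G" and r: "r \<in> carrier R" for r g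
  proof -
    have gc: "g \<in> carrier M" using g G by blast
    have "stable_additive S {r \<in> carrier R. r \<odot>\<^bsub>M\<^esub> g \<in> W}"
      using W(1) gc Sc
      by (auto simp: stable_additive_def additive_subgroup_iff stable_subgroups_iff smult_l_distr
          smult_l_minus smult_assoc1 subset_iff)
    from carrier_subset_if_monomials[OF Sc T gen this] show ?thesis using mon[OF g] T r by auto
  qed
  let ?X = "{x \<in> carrier M. \<forall>r\<in>carrier R. r \<odot>\<^bsub>M\<^esub> x \<in> W}"
  have "?X \<in> stable_subgroups M (carrier R)"
    using W(1) by (auto simp: stable_subgroups_iff smult_r_distr smult_r_minus smult_assoc1[symmetric])
  moreover have "G \<subseteq> ?X" using all G by auto
  ultimately have "module_span R M G \<subseteq> ?X" by (rule span_least)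
  then have "\<one> \<odot>\<^bsub>M\<^esub> x \<in> W" if "x \<in> carrier M" for x using that G(3) by blast
  then have "W = carrier M" using Wc by auto
  then have "relative_length M S N (carrier M) \<noteq> \<infinity>" using W(4) by simp
  moreover have "relative_length M (carrier R) N (carrier M) \<le> relative_length M S N (carrier M)"
    by (rule relative_length_mono) (use Sc in auto)
  ultimately show ?thesis by (metis enat_ord_simps(5))
qed

end

section \<open>The Frobenius map\<close>

context cring
begin

text \<open>Induction by Pascal's rule: \<open>A\<close> and \<open>B\<close> are the two summands of a binomial coefficient of \<open>Suc n\<close>,
  extended by zero at the ends of the range.\<close>
lemma binomial_theorem:
  assumes x: "x \<in> carrier R" and y: "y \<in> carrier R"
  shows "(x \<oplus> y) [^] n = (\<Oplus>k\<in>{..n}. [(n choose k)] \<cdot>\<^bsub>R\<^esub> (x [^] k \<otimes> y [^] (n - k)))"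
proof (induction n)
  case 0
  show ?case by simp
next
  case (Suc n)
  let ?t = "\<lambda>k. [(n choose k)] \<cdot>\<^bsub>R\<^esub> (x [^] k \<otimes> y [^] (n - k))"
  let ?A = "\<lambda>k. [(n choose k)] \<cdot>\<^bsub>R\<^esub> (x [^] k \<otimes> y [^] (Suc n - k))"
  let ?B = "\<lambda>k. if k = 0 then \<zero> else [(n choose (k - 1))] \<cdot>\<^bsub>R\<^esub> (x [^] k \<otimes> y [^] (Suc n - k))"
  have A: "(\<Oplus>k\<in>{..n}. ?t k) \<otimes> y = (\<Oplus>k\<in>{..Suc n}. ?A k)"
  proof -
    have "(\<Oplus>k\<in>{..n}. ?t k) \<otimes> y = (\<Oplus>k\<in>{..n}. ?t k \<otimes> y)"
      by (rule finsum_ldistr) (use x y in auto)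
    also have "\<dots> = (\<Oplus>k\<in>{..n}. ?A k)"
      by (rule finsum_cong') (use x y in \<open>auto simp: add_pow_ldistr m_assoc Suc_diff_le\<close>)
    also have "\<dots> = (\<Oplus>k\<in>{..Suc n}. ?A k)"
      using x y by (subst finsum_Suc) (auto simp: binomial_eq_0)
    finally show ?thesis .
  qed
  have B: "(\<Oplus>k\<in>{..n}. ?t k) \<otimes> x = (\<Oplus>k\<in>{..Suc n}. ?B k)"
  proof -
    have "(\<Oplus>k\<in>{..n}. ?t k) \<otimes> x = (\<Oplus>k\<in>{..n}. ?t k \<otimes> x)"
      by (rule finsum_ldistr) (use x y in auto)
    also have "\<dots> = (\<Oplus>k\<in>{..n}. ?B (Suc k))"
      by (rule finsum_cong') (use x y in \<open>auto simp: add_pow_ldistr add_pow_rdistr m_ac\<close>)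
    also have "\<dots> = (\<Oplus>k\<in>{..Suc n}. ?B k)"
      using x y by (subst finsum_Suc2) auto
    finally show ?thesis .
  qed
  have "(x \<oplus> y) [^] Suc n = (\<Oplus>k\<in>{..n}. ?t k) \<otimes> x \<oplus> (\<Oplus>k\<in>{..n}. ?t k) \<otimes> y"
    using Suc x y by (simp add: r_distr)
  also have "\<dots> = (\<Oplus>k\<in>{..Suc n}. ?B k \<oplus> ?A k)"
    unfolding A B using x y by (subst add.finprod_multf) auto
  also have "\<dots> = (\<Oplus>k\<in>{..Suc n}. [(Suc n choose k)] \<cdot>\<^bsub>R\<^esub> (x [^] k \<otimes> y [^] (Suc n - k)))"
  proof (rule finsum_cong')
    fix k
    show "?B k \<oplus> ?A k = [(Suc n choose k)] \<cdot>\<^bsub>R\<^esub> (x [^] k \<otimes> y [^] (Suc n - k))"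
      using x y by (cases k) (auto simp: add.nat_pow_mult)
  qed (use x y in auto)
  finally show ?case .
qed

lemma frobenius_add:
  assumes p: "prime (p :: nat)" and char: "[p] \<cdot>\<^bsub>R\<^esub> \<one> = \<zero>" and x: "x \<in> carrier R" and y: "y \<in> carrier R"
  shows "(x \<oplus> y) [^] p = x [^] p \<oplus> y [^] p"
proof -
  let ?t = "\<lambda>k. [(p choose k)] \<cdot>\<^bsub>R\<^esub> (x [^] k \<otimes> y [^] (p - k))"
  have p0: "p \<noteq> 0" using p by (metis not_prime_0)
  have pz: "[p] \<cdot>\<^bsub>R\<^esub> z = \<zero>" if "z \<in> carrier R" for z
  proof -
    have "[p] \<cdot>\<^bsub>R\<^esub> z = ([p] \<cdot>\<^bsub>R\<^esub> \<one>) \<otimes> z" using that by (simp add: add_pow_ldistr)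
    then show ?thesis using that char by simp
  qed
  have zero: "?t k = \<zero>" if k: "k \<in> {..p} - {0, p}" for k
  proof -
    have "p dvd (p choose k)" using k p p0 by (intro dvd_choose_prime) auto
    then obtain m where "p choose k = m * p" by (metis dvd_def mult.commute)
    then have "?t k = [m] \<cdot>\<^bsub>R\<^esub> ([p] \<cdot>\<^bsub>R\<^esub> (x [^] k \<otimes> y [^] (p - k)))"
      using x y by (simp add: add.nat_pow_pow mult.commute)
    then show ?thesis using pz x y by simp
  qed
  have "(x \<oplus> y) [^] p = (\<Oplus>k\<in>{..p}. ?t k)" by (rule binomial_theorem[OF x y])
  also have "\<dots> = (\<Oplus>k\<in>{0, p}. ?t k)"
    by (rule add.finprod_mono_neutral_cong_left[symmetric]) (use zero x y in auto)
  also have "\<dots> = ?t 0 \<oplus> ?t p"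
    using x y p0 by (subst finsum_insert) auto
  also have "\<dots> = x [^] p \<oplus> y [^] p" using x y by (simp add: a_comm)
  finally show ?thesis .
qed

lemma frobenius_power_add:
  assumes p: "prime (p :: nat)" and char: "[p] \<cdot>\<^bsub>R\<^esub> \<one> = \<zero>" and x: "x \<in> carrier R" and y: "y \<in> carrier R"
  shows "(x \<oplus> y) [^] (p ^ n) = x [^] (p ^ n) \<oplus> y [^] (p ^ n)"
proof (induction n)
  case 0
  show ?case using x y by simp
next
  case (Suc n)
  have pow: "z [^] (p ^ Suc n) = (z [^] (p ^ n)) [^] p" if "z \<in> carrier R" for z
    using that by (simp add: nat_pow_pow mult.commute)
  show ?case using Suc x y frobenius_add[OF p char] by (simp add: pow del: power_Suc)
qed

end

lemma (in field) prime_characteristic: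
  assumes char: "has_characteristic R p" and p: "p > 0"
  shows "prime p"
proof -
  have c: "[n] \<cdot>\<^bsub>R\<^esub> \<one> = \<zero> \<longleftrightarrow> p dvd n" for n :: nat using char by (simp add: has_characteristic_def)
  show ?thesis
    unfolding prime_nat_iff
  proof (intro conjI allI impI)
    have "p \<noteq> 1" using c[of 1] one_not_zero by auto
    then show "1 < p" using p by simp
  next
    fix m assume "m dvd p"
    then obtain k where k: "p = m * k" by blast
    have "([m] \<cdot>\<^bsub>R\<^esub> \<one>) \<otimes> ([k] \<cdot>\<^bsub>R\<^esub> \<one>) = [(m * k)] \<cdot>\<^bsub>R\<^esub> \<one>"
      by (simp add: add_pow_ldistr add_pow_rdistr add.nat_pow_pow mult.commute)
    also have "\<dots> = \<zero>" using c k by auto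
    finally have "[m] \<cdot>\<^bsub>R\<^esub> \<one> = \<zero> \<or> [k] \<cdot>\<^bsub>R\<^esub> \<one> = \<zero>" by (intro integral) auto
    then have "p dvd m \<or> p dvd k" using c by simp
    then show "m = 1 \<or> m = p" using k p by (auto dest: dvd_imp_le simp: dvd_antisym)
  qed
qed

lemma (in algebra) nat_multiple_one_zero:
  assumes "[n] \<cdot>\<^bsub>R\<^esub> \<one>\<^bsub>R\<^esub> = \<zero>\<^bsub>R\<^esub>"
  shows "[(n::nat)] \<cdot>\<^bsub>M\<^esub> \<one>\<^bsub>M\<^esub> = \<zero>\<^bsub>M\<^esub>"
proof -
  have "[n] \<cdot>\<^bsub>M\<^esub> \<one>\<^bsub>M\<^esub> = ([n] \<cdot>\<^bsub>R\<^esub> \<one>\<^bsub>R\<^esub>) \<odot>\<^bsub>M\<^esub> \<one>\<^bsub>M\<^esub>"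
    by (induction n) (auto simp: smult_l_distr)
  then show ?thesis using assms by simp
qed

section \<open>Graded algebras\<close>

context nat_graded_algebra
begin

lemma ring_cring: "cring R"
  by (rule M_cring)

lemma ring_graded: "graded_group R Rd"
  using direct_sum by (intro graded_group.intro graded_group_axioms.intro M.abelian_group_axioms)

lemma degree_zero_image: "(\<lambda>c. c \<odot>\<^bsub>R\<^esub> \<one>\<^bsub>R\<^esub>) ` carrier K = Rd 0"
  using degree_zero by (simp add: bij_betw_def)

lemma one_degree: "\<one>\<^bsub>R\<^esub> \<in> Rd 0"
proof -
  have "\<one>\<^bsub>K\<^esub> \<odot>\<^bsub>R\<^esub> \<one>\<^bsub>R\<^esub> = \<one>\<^bsub>R\<^esub>" by simp
  moreover have "\<one>\<^bsub>K\<^esub> \<odot>\<^bsub>R\<^esub> \<one>\<^bsub>R\<^esub> \<in> (\<lambda>c. c \<odot>\<^bsub>R\<^esub> \<one>\<^bsub>R\<^esub>) ` carrier K"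
    by (intro imageI R.one_closed)
  ultimately show ?thesis by (simp only: degree_zero_image)
qed

lemma pow_degree: "x \<in> Rd d \<Longrightarrow> x [^]\<^bsub>R\<^esub> (n::nat) \<in> Rd (d * n)"
proof (induction n)
  case 0
  show ?case using one_degree by simp
next
  case (Suc n)
  then have "x [^]\<^bsub>R\<^esub> n \<otimes>\<^bsub>R\<^esub> x \<in> Rd (d * n + d)" by (intro mult_degree) auto
  then show ?case by (simp add: add.commute)
qed

lemma degree_zero_division:
  assumes "field K" and c: "c \<in> Rd 0" "c \<noteq> \<zero>\<^bsub>R\<^esub>"
  shows "\<exists>d\<in>Rd 0. d \<otimes>\<^bsub>R\<^esub> c = \<one>\<^bsub>R\<^esub>"
proof -
  interpret K: field K by fact
  obtain k where k: "k \<in> carrier K" "c = k \<odot>\<^bsub>R\<^esub> \<one>\<^bsub>R\<^esub>" using c degree_zero_image by blast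
  have "k \<noteq> \<zero>\<^bsub>K\<^esub>" using k c by auto
  then have u: "k \<in> Units K" using k K.field_Units by simp
  let ?l = "inv\<^bsub>K\<^esub> k"
  have l: "?l \<in> carrier K" "?l \<otimes>\<^bsub>K\<^esub> k = \<one>\<^bsub>K\<^esub>" using u by auto
  have "(?l \<odot>\<^bsub>R\<^esub> \<one>\<^bsub>R\<^esub>) \<otimes>\<^bsub>R\<^esub> c = ?l \<odot>\<^bsub>R\<^esub> (\<one>\<^bsub>R\<^esub> \<otimes>\<^bsub>R\<^esub> (k \<odot>\<^bsub>R\<^esub> \<one>\<^bsub>R\<^esub>))"
    unfolding k(2) using l(1) k(1) by (intro smult_assoc2) auto
  also have "\<dots> = (?l \<otimes>\<^bsub>K\<^esub> k) \<odot>\<^bsub>R\<^esub> \<one>\<^bsub>R\<^esub>" using l(1) k(1) by (simp add: smult_assoc1)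
  also have "\<dots> = \<one>\<^bsub>R\<^esub>" using l(2) by simp
  finally show ?thesis using l(1) degree_zero_image by blast
qed

end

text \<open>The components of positive degree of given generators. Those of degree zero already lie in the base
  field.\<close>
lemma homogeneous_generators:
  assumes graded: "nat_graded_algebra K R Rd" and "fin_gen_algebra K R"
  shows "\<exists>T. finite T \<and> T \<subseteq> (\<Union>n\<in>{0<..}. Rd n) \<and> generate_ring R (Rd 0 \<union> T) = carrier R"
proof -
  interpret C: cring R by (rule nat_graded_algebra.ring_cring[OF graded])
  interpret G: graded_group R Rd by (rule nat_graded_algebra.ring_graded[OF graded])
  note degree_zero_image = nat_graded_algebra.degree_zero_image[OF graded]
  obtain S where S: "finite S" "S \<subseteq> carrier R" "generate_ring R (Rd 0 \<union> S) = carrier R"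
    using assms by (auto simp: fin_gen_algebra_def degree_zero_image)
  define T where "T = (\<Union>s\<in>S. (\<lambda>n. G.component n s) ` {n. G.component n s \<noteq> \<zero>\<^bsub>R\<^esub>} \<inter> (\<Union>n\<in>{0<..}. Rd n))"
  have T: "finite T" "T \<subseteq> (\<Union>n\<in>{0<..}. Rd n)"
    using S G.finite_support unfolding T_def by (auto intro!: finite_UN_I finite_Int)
  let ?E = "generate_ring R (Rd 0 \<union> T)"
  have Tc: "Rd 0 \<union> T \<subseteq> carrier R" using T(2) G.piece_carrier by blast
  have E: "subring ?E R" by (rule C.generate_ring_is_subring[OF Tc])
  then have Eadd: "subgroup ?E (add_monoid R)" by (simp add: subring_def)
  have "s \<in> ?E" if s: "s \<in> S" for s
  proof (rule G.mem_subgroup_if_components[OF Eadd])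
    show sc: "s \<in> carrier R" using s S by blast
    fix n
    have c: "G.component n s \<in> Rd n" by (rule G.component_mem[OF sc])
    consider "n = 0" | "G.component n s = \<zero>\<^bsub>R\<^esub>" | "n > 0" "G.component n s \<noteq> \<zero>\<^bsub>R\<^esub>" by blast
    then show "G.component n s \<in> ?E"
    proof cases
      case 1
      then show ?thesis using c by (auto intro: generate_ring.incl)
    next
      case 2
      then show ?thesis using C.zero_in_generate by simp
    next
      case 3
      then have "G.component n s \<in> T" using s c by (auto simp: T_def)
      then show ?thesis by (auto intro: generate_ring.incl)
    qed
  qed
  then have "Rd 0 \<union> S \<subseteq> ?E" by (auto intro: generate_ring.incl)
  then have "generate_ring R (Rd 0 \<union> S) \<subseteq> ?E"
    using C.generate_ring_min_subring1[OF _ E] S(2) G.piece_subset by auto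
  then have "?E = carrier R" using S(3) C.generate_ring_incl[OF Tc] by auto
  then show ?thesis using T by blast
qed

lemma finsum_regular_module: "finsum (regular_module R) f A = finsum R f A"
  by (simp add: finsum_def finprod_def regular_module_def)

text \<open>The ring as a graded module over itself. Extending the grading by zero to negative degrees makes the
  results on modules graded by integers available for ideals.\<close>
lemma regular_module_graded:
  assumes graded: "nat_graded_algebra K R Rd"
  shows "module_over_graded_ring R (regular_module R) Rd (\<lambda>j. if j \<ge> 0 then Rd (nat j) else {\<zero>\<^bsub>R\<^esub>})"
    (is "module_over_graded_ring R ?Q Rd ?Md")
proof -
  interpret C: cring R by (rule nat_graded_algebra.ring_cring[OF graded])
  interpret G: graded_group R Rd by (rule nat_graded_algebra.ring_graded[OF graded])
  note mult_degree = nat_graded_algebra.mult_degree[OF graded]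
  have piece: "subgroup (?Md j) (add_monoid R)" for j
    using G.piece_subgroup[of "nat j"] by (auto simp: additive_subgroup_iff)
  have reindex: "G.is_decomposition x (\<lambda>n. g (int n))"
    if g: "\<forall>j. g j \<in> ?Md j" "finite {j. g j \<noteq> \<zero>\<^bsub>R\<^esub>}" "x = (\<Oplus>\<^bsub>R\<^esub>j\<in>{j. g j \<noteq> \<zero>\<^bsub>R\<^esub>}. g j)" for x g
  proof -
    have nat: "{j. g j \<noteq> \<zero>\<^bsub>R\<^esub>} = int ` {n. g (int n) \<noteq> \<zero>\<^bsub>R\<^esub>}"
    proof (intro Set.set_eqI iffI)
      fix j assume j: "j \<in> {j. g j \<noteq> \<zero>\<^bsub>R\<^esub>}"
      then have "j \<ge> 0" using g(1)[rule_format, of j] by (auto split: if_splits)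
      then show "j \<in> int ` {n. g (int n) \<noteq> \<zero>\<^bsub>R\<^esub>}" using j by (intro image_eqI[of _ _ "nat j"]) auto
    qed auto
    have mem: "g (int n) \<in> Rd n" for n using g(1)[rule_format, of "int n"] by simp
    have "finite {n. g (int n) \<noteq> \<zero>\<^bsub>R\<^esub>}" using g(2) unfolding nat by (rule finite_imageD) simp
    moreover have "x = (\<Oplus>\<^bsub>R\<^esub>n\<in>{n. g (int n) \<noteq> \<zero>\<^bsub>R\<^esub>}. g (int n))"
      unfolding g(3) nat by (rule C.add.finprod_reindex) (use mem G.piece_carrier in auto)
    ultimately show ?thesis using mem by (simp add: G.is_decomposition_def)
  qed
  have "\<exists>!f. (\<forall>j. f j \<in> ?Md j) \<and> finite {j. f j \<noteq> \<zero>\<^bsub>R\<^esub>} \<and> x = (\<Oplus>\<^bsub>R\<^esub>j\<in>{j. f j \<noteq> \<zero>\<^bsub>R\<^esub>}. f j)"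
    if x: "x \<in> carrier R" for x
  proof (rule ex1I)
    let ?f = "\<lambda>j. if j \<ge> 0 then G.component (nat j) x else \<zero>\<^bsub>R\<^esub>"
    have supp: "{j. ?f j \<noteq> \<zero>\<^bsub>R\<^esub>} = int ` {n. G.component n x \<noteq> \<zero>\<^bsub>R\<^esub>}"
    proof (intro Set.set_eqI iffI)
      fix j assume j: "j \<in> {j. ?f j \<noteq> \<zero>\<^bsub>R\<^esub>}"
      then show "j \<in> int ` {n. G.component n x \<noteq> \<zero>\<^bsub>R\<^esub>}"
        by (intro image_eqI[of _ _ "nat j"]) (auto split: if_splits)
    qed auto
    have "x = (\<Oplus>\<^bsub>R\<^esub>n\<in>{n. G.component n x \<noteq> \<zero>\<^bsub>R\<^esub>}. G.component n x)" by (rule G.component_sum[OF x])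
    also have "\<dots> = (\<Oplus>\<^bsub>R\<^esub>n\<in>{n. G.component n x \<noteq> \<zero>\<^bsub>R\<^esub>}. ?f (int n))" by simp
    also have "\<dots> = (\<Oplus>\<^bsub>R\<^esub>j\<in>{j. ?f j \<noteq> \<zero>\<^bsub>R\<^esub>}. ?f j)"
      unfolding supp by (rule C.add.finprod_reindex[symmetric]) (use x in auto)
    finally have "x = (\<Oplus>\<^bsub>R\<^esub>j\<in>{j. ?f j \<noteq> \<zero>\<^bsub>R\<^esub>}. ?f j)" .
    moreover have "finite {j. ?f j \<noteq> \<zero>\<^bsub>R\<^esub>}" unfolding supp using G.finite_support[OF x] by simp
    moreover have "\<forall>j. ?f j \<in> ?Md j" using G.component_mem[OF x] by simp
    ultimately show "(\<forall>j. ?f j \<in> ?Md j) \<and> finite {j. ?f j \<noteq> \<zero>\<^bsub>R\<^esub>} \<and>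
        x = (\<Oplus>\<^bsub>R\<^esub>j\<in>{j. ?f j \<noteq> \<zero>\<^bsub>R\<^esub>}. ?f j)" by blast
    fix g assume g: "(\<forall>j. g j \<in> ?Md j) \<and> finite {j. g j \<noteq> \<zero>\<^bsub>R\<^esub>} \<and>
        x = (\<Oplus>\<^bsub>R\<^esub>j\<in>{j. g j \<noteq> \<zero>\<^bsub>R\<^esub>}. g j)"
    show "g = ?f"
    proof
      fix j
      show "g j = ?f j"
      proof (cases "j \<ge> 0")
        case True
        have "G.is_decomposition x (\<lambda>n. g (int n))" using g reindex by blast
        then have "G.component (nat j) x = g (int (nat j))" by (rule G.component_unique[OF _ x])
        then show ?thesis using True by simp
      next
        case False
        then show ?thesis using g by (metis singletonD)
      qed
    qed
  qed
  then have ds: "internal_direct_sum ?Q ?Md"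
    unfolding internal_direct_sum_def additive_subgroup_regular_module finsum_regular_module
    unfolding regular_module_simps using piece by blast
  have "int_graded_module R ?Q Rd ?Md"
  proof (intro int_graded_module.intro int_graded_module_axioms.intro ds)
    show "module R ?Q" by (rule regular_module_is_module[OF C.is_cring])
    fix x n m j assume x: "x \<in> Rd n" and m: "m \<in> ?Md j"
    show "x \<odot>\<^bsub>?Q\<^esub> m \<in> ?Md (int n + j)"
    proof (cases "j \<ge> 0")
      case True
      then have "x \<otimes>\<^bsub>R\<^esub> m \<in> Rd (n + nat j)" using x m by (intro mult_degree) auto
      moreover have "nat (int n + j) = n + nat j" using True by (simp add: nat_add_distrib)
      ultimately show ?thesis using True by (simp add: regular_module_simps)
    next
      case False
      then have "x \<otimes>\<^bsub>R\<^esub> m = \<zero>\<^bsub>R\<^esub>" using m x G.piece_carrier by auto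
      moreover have "\<zero>\<^bsub>R\<^esub> \<in> ?Md (int n + j)" using piece by (simp add: additive_subgroup_iff)
      ultimately show ?thesis by (simp add: regular_module_simps)
    qed
  qed
  then show ?thesis by (intro module_over_graded_ring.intro G.graded_group_axioms)
qed

text \<open>This is \<open>eventually_piece_subset\<close> for the ring as a module over itself.\<close>
lemma high_degrees_in_ideal:
  assumes graded: "nat_graded_algebra K R Rd" and I: "homogeneous_ideal R Rd I" and fin: "finite_colength R I"
  shows "\<exists>b. \<forall>n\<ge>b. Rd n \<subseteq> I"
proof -
  let ?Md = "\<lambda>j::int. if j \<ge> 0 then Rd (nat j) else {\<zero>\<^bsub>R\<^esub>}"
  interpret C: cring R by (rule nat_graded_algebra.ring_cring[OF graded])
  interpret Q: module_over_graded_ring R "regular_module R" Rd ?Md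
    by (rule regular_module_graded[OF graded])
  obtain H where H: "H \<subseteq> (\<Union>n. Rd n)" "I = Idl\<^bsub>R\<^esub> H" using I by (auto simp: homogeneous_ideal_def)
  have Hc: "H \<subseteq> carrier R" using H Q.R_graded.piece_carrier by blast
  have "Rd n = ?Md (int n)" for n by simp
  then have pieces: "(\<Union>n. Rd n) \<subseteq> (\<Union>j. ?Md j)" by blast
  have hom: "Q.homogeneous_submodule I"
  proof (rule Q.homogeneous_if_generated)
    show "I \<in> stable_subgroups (regular_module R) (carrier R)"
      using C.genideal_ideal[OF Hc] H ideal_iff_stable_regular[OF C.is_cring] by simp
    show "H \<subseteq> I" using C.genideal_self[OF Hc] H by simp
    show "H \<subseteq> (\<Union>j. ?Md j)" using H pieces by blast
    show "I \<subseteq> L" if "L \<in> stable_subgroups (regular_module R) (carrier R)" "H \<subseteq> L" for L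
      using C.genideal_minimal that H ideal_iff_stable_regular[OF C.is_cring] by blast
  qed
  have "relative_length (regular_module R) (carrier R) I (carrier (regular_module R)) \<noteq> \<infinity>"
    using fin Q.module_length_quotient_module[OF Q.homogeneous_stable[OF hom]] by (simp add: finite_colength_def)
  then obtain b where b: "\<And>j. j \<ge> b \<Longrightarrow> ?Md j \<subseteq> I" using Q.eventually_piece_subset[OF hom] by blast
  have "Rd n \<subseteq> I" if "n \<ge> nat b" for n
    using b[of "int n"] that by auto
  then show ?thesis by blast
qed

section \<open>Bracket powers\<close>

text \<open>For an ideal \<open>I\<close> generated by a set \<open>H\<close> of elements with homogeneous \<open>q\<close>-th powers,
  \<open>I\<^sup>[\<^sup>q\<^sup>] M\<close> is generated by the elements \<open>h\<^sup>q m\<close> with \<open>h \<in> H\<close> and homogeneous \<open>m\<close>. To see this, let \<open>L\<close> be a submodule that contains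
  these elements. The scalars that map \<open>M\<close> into \<open>L\<close> form an ideal \<open>C\<close>, and since the \<open>q\<close>-th power is
  additive, the elements whose \<open>q\<close>-th power lies in \<open>C\<close> form an ideal \<open>B\<close> as well. The ideal \<open>B\<close>
  contains \<open>H\<close>, hence \<open>I\<close>, so \<open>C\<close> contains \<open>I\<^sup>[\<^sup>q\<^sup>]\<close>.\<close>
lemma (in module_over_graded_ring) bracket_power_homogeneous:
  assumes frob: "\<And>x y. x \<in> carrier R \<Longrightarrow> y \<in> carrier R \<Longrightarrow> (x \<oplus> y) [^] q = x [^] q \<oplus> y [^] q"
    and q: "q > 0"
    and H: "H \<subseteq> carrier R" "\<And>h. h \<in> H \<Longrightarrow> \<exists>n. h [^] q \<in> Rd n"
  shows "homogeneous_submodule (ideal_smult R M (bracket_power R (Idl\<^bsub>R\<^esub> H) q))"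
    and "x \<in> Idl\<^bsub>R\<^esub> H \<Longrightarrow> m \<in> carrier M \<Longrightarrow>
      x [^] q \<odot>\<^bsub>M\<^esub> m \<in> ideal_smult R M (bracket_power R (Idl\<^bsub>R\<^esub> H) q)"
proof -
  let ?I = "Idl\<^bsub>R\<^esub> H"
  let ?P = "{x [^] q | x. x \<in> ?I}"
  let ?J = "bracket_power R ?I q"
  let ?G = "{a \<odot>\<^bsub>M\<^esub> m | a m. a \<in> ?J \<and> m \<in> carrier M}"
  have I: "ideal ?I R" by (rule R.genideal_ideal[OF H(1)])
  have Ic: "?I \<subseteq> carrier R" using I by (rule ideal.Icarr[THEN subsetI])
  have Pc: "?P \<subseteq> carrier R" using Ic by auto
  have J: "ideal ?J R" unfolding bracket_power_def by (rule R.genideal_ideal[OF Pc])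
  have Jc: "?J \<subseteq> carrier R" using J by (rule ideal.Icarr[THEN subsetI])
  have PJ: "?P \<subseteq> ?J" unfolding bracket_power_def by (rule R.genideal_self[OF Pc])
  have Gc: "?G \<subseteq> carrier M" using Jc by auto
  let ?N = "ideal_smult R M ?J"
  have GN: "?G \<subseteq> ?N" unfolding ideal_smult_def by (rule span_superset)
  show mem: "x [^] q \<odot>\<^bsub>M\<^esub> m \<in> ?N" if "x \<in> ?I" "m \<in> carrier M" for x m
    using that PJ GN by blast
  show "homogeneous_submodule ?N"
  proof (rule homogeneous_if_generated)
    let ?X = "{h [^] q \<odot>\<^bsub>M\<^esub> m | h m. h \<in> H \<and> m \<in> (\<Union>j. Md j)}"
    show "?N \<in> stable_subgroups M (carrier R)" unfolding ideal_smult_def by (rule span_stable[OF Gc])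
    have "H \<subseteq> ?I" by (rule R.genideal_self[OF H(1)])
    then show "?X \<subseteq> ?N" using mem M_graded.piece_carrier by blast
    show "?X \<subseteq> (\<Union>j. Md j)"
    proof
      fix y assume "y \<in> ?X"
      then obtain h m j where hm: "h \<in> H" "m \<in> Md j" "y = h [^] q \<odot>\<^bsub>M\<^esub> m" by blast
      obtain n where "h [^] q \<in> Rd n" using H(2)[OF hm(1)] by blast
      from smult_degree[OF this hm(2)] show "y \<in> (\<Union>j. Md j)" unfolding hm(3) by blast
    qed
    fix L assume L: "L \<in> stable_subgroups M (carrier R)" and XL: "?X \<subseteq> L"
    have L_closed: "\<zero>\<^bsub>M\<^esub> \<in> L" "\<And>x y. x \<in> L \<Longrightarrow> y \<in> L \<Longrightarrow> x \<oplus>\<^bsub>M\<^esub> y \<in> L"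
      "\<And>x. x \<in> L \<Longrightarrow> \<ominus>\<^bsub>M\<^esub> x \<in> L" "\<And>a x. a \<in> carrier R \<Longrightarrow> x \<in> L \<Longrightarrow> a \<odot>\<^bsub>M\<^esub> x \<in> L"
      using L by (auto simp: stable_subgroups_iff)
    define C where "C = {a \<in> carrier R. \<forall>m\<in>carrier M. a \<odot>\<^bsub>M\<^esub> m \<in> L}"
    have C: "ideal C R"
    proof (rule R.ideal_if_stable)
      show "subgroup C (add_monoid R)"
        using L_closed by (auto simp: additive_subgroup_iff C_def smult_l_distr smult_l_minus)
      show "r \<otimes> a \<in> C" if "a \<in> C" "r \<in> carrier R" for a r
        using that L_closed(4) by (auto simp: C_def smult_assoc1)
    qed
    have Cadd: "\<zero> \<in> C" "\<And>x y. x \<in> C \<Longrightarrow> y \<in> C \<Longrightarrow> x \<oplus> y \<in> C"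
      "\<And>a r. a \<in> C \<Longrightarrow> r \<in> carrier R \<Longrightarrow> r \<otimes> a \<in> C"
    proof -
      interpret C: ideal C R by fact
      show "\<zero> \<in> C" by (rule C.zero_closed)
      show "x \<oplus> y \<in> C" if "x \<in> C" "y \<in> C" for x y using that by (rule C.a_closed)
      show "r \<otimes> a \<in> C" if "a \<in> C" "r \<in> carrier R" for a r using that by (rule C.I_l_closed)
    qed
    define B where "B = {x \<in> carrier R. x [^] q \<in> C}"
    have Bmult: "r \<otimes> a \<in> B" if "a \<in> B" "r \<in> carrier R" for a r
      using that Cadd(3) by (auto simp: B_def R.nat_pow_distrib)
    have B: "ideal B R"
    proof (rule R.ideal_if_stable)
      have "\<ominus> x \<in> B" if x: "x \<in> B" for x
      proof -
        have xc: "x \<in> carrier R" using x by (simp add: B_def)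
        have "\<ominus> \<one> \<otimes> x = \<ominus> x" using xc by (simp add: R.l_minus)
        then show ?thesis using Bmult[OF x, of "\<ominus> \<one>"] by simp
      qed
      moreover have "\<zero> \<in> B" using Cadd(1) q by (simp add: B_def R.nat_pow_zero)
      ultimately show "subgroup B (add_monoid R)"
        using Cadd(2) frob by (auto simp: additive_subgroup_iff B_def)
    qed (rule Bmult)
    have "H \<subseteq> B"
    proof
      fix h assume h: "h \<in> H"
      have hc: "h \<in> carrier R" using h H by blast
      have "subgroup {m \<in> carrier M. h [^] q \<odot>\<^bsub>M\<^esub> m \<in> L} (add_monoid M)"
        using hc L_closed by (auto simp: additive_subgroup_iff smult_r_distr smult_r_minus)
      then have "carrier M \<subseteq> {m \<in> carrier M. h [^] q \<odot>\<^bsub>M\<^esub> m \<in> L}"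
        by (rule M_graded.carrier_subset_if_homogeneous)
          (use h XL M_graded.piece_carrier in auto)
      then show "h \<in> B" using hc by (auto simp: B_def C_def)
    qed
    then have "?I \<subseteq> B" by (rule R.genideal_minimal[OF B])
    then have "?P \<subseteq> C" by (auto simp: B_def)
    then have "?J \<subseteq> C" unfolding bracket_power_def by (rule R.genideal_minimal[OF C])
    then have "?G \<subseteq> L" by (auto simp: C_def)
    then show "?N \<subseteq> L" unfolding ideal_smult_def by (rule span_least[OF L])
  qed
qed

section \<open>Lengths of quotients by bracket powers\<close>

text \<open>The equality of the terms of the two sequences.\<close>
lemma length_eq_sum_of_graded_lengths:
  assumes "field K" and char: "has_characteristic K p" and p: "p > 0"
    and gr: "nat_graded_algebra K R Rd" and fgR: "fin_gen_algebra K R"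
    and I: "homogeneous_ideal R Rd I" and fin: "finite_colength R I"
    and grM: "int_graded_module R M Rd Md" and fgM: "fin_gen_module R M"
    and N: "N = ideal_smult R M (bracket_power R I (p ^ n))"
  shows "of_nat (the_enat (module_length R (quotient_module M N))) =
    (\<Sum>\<^sub>\<infinity>j\<in>UNIV. complex_of_nat (the_enat (module_length K (quotient_piece R M Md N j))))"
proof -
  interpret K: field K by fact
  interpret C: cring R by (rule nat_graded_algebra.ring_cring[OF gr])
  interpret A: nat_graded_algebra K R Rd by fact
  interpret G: module_over_graded_ring R M Rd Md
    by (intro module_over_graded_ring.intro grM A.ring_graded)
  let ?q = "p ^ n"
  have prime: "prime p" by (rule K.prime_characteristic[OF char p])
  have "[p] \<cdot>\<^bsub>K\<^esub> \<one>\<^bsub>K\<^esub> = \<zero>\<^bsub>K\<^esub>" using char by (simp add: has_characteristic_def)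
  then have pR: "[p] \<cdot>\<^bsub>R\<^esub> \<one>\<^bsub>R\<^esub> = \<zero>\<^bsub>R\<^esub>" by (rule A.nat_multiple_one_zero)
  obtain H where H: "H \<subseteq> (\<Union>n. Rd n)" "I = Idl\<^bsub>R\<^esub> H" using I by (auto simp: homogeneous_ideal_def)
  have Hc: "H \<subseteq> carrier R" using H G.R_graded.piece_carrier by blast
  have Hq: "\<exists>n. h [^]\<^bsub>R\<^esub> ?q \<in> Rd n" if "h \<in> H" for h using that H A.pow_degree by blast
  have q: "?q > 0" using p by simp
  note frob = C.frobenius_power_add[OF prime pR]
  have hom: "G.homogeneous_submodule N"
    unfolding N H(2) by (rule G.bracket_power_homogeneous(1)[OF _ q Hc]) (fact frob, fact Hq)
  have bracket: "y [^]\<^bsub>R\<^esub> ?q \<odot>\<^bsub>M\<^esub> x \<in> N" if y: "y \<in> I" and x: "x \<in> carrier M" for x y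
    unfolding N H(2)
    by (rule G.bracket_power_homogeneous(2)[OF _ q Hc _ y[unfolded H(2)] x]) (fact frob, fact Hq)
  obtain b where b: "\<And>n. n \<ge> b \<Longrightarrow> Rd n \<subseteq> I" using high_degrees_in_ideal[OF gr I fin] by blast
  obtain T where T: "finite T" "T \<subseteq> (\<Union>n\<in>{0<..}. Rd n)" "generate_ring R (Rd 0 \<union> T) = carrier R"
    using homogeneous_generators[OF gr fgR] by blast
  have Tc: "T \<subseteq> carrier R" using T(2) G.R_graded.piece_carrier by blast
  \<comment> \<open>The power \<open>t\<^sup>b\<close> has degree at least \<open>b\<close> since \<open>t\<close> has positive degree, so it lies in \<open>I\<close>.\<close>
  have pow: "t [^]\<^bsub>R\<^esub> (b * ?q) \<odot>\<^bsub>M\<^esub> x \<in> N" if t: "t \<in> T" and x: "x \<in> carrier M" for t x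
  proof -
    obtain d where d: "d > 0" "t \<in> Rd d" using t T(2) by blast
    then have "t [^]\<^bsub>R\<^esub> b \<in> Rd (d * b)" by (intro A.pow_degree)
    moreover have "d * b \<ge> b" using d by simp
    ultimately have "t [^]\<^bsub>R\<^esub> b \<in> I" using b by blast
    then have "(t [^]\<^bsub>R\<^esub> b) [^]\<^bsub>R\<^esub> ?q \<odot>\<^bsub>M\<^esub> x \<in> N" by (rule bracket[OF _ x])
    then show ?thesis using t Tc by (simp add: C.nat_pow_pow subset_iff)
  qed
  have "relative_length M (carrier R) N (carrier M) \<noteq> \<infinity>"
  proof (rule G.finite_length_if_nilpotent_generators[OF _ _ A.one_degree _ T(1) Tc T(3) fgM _ pow])
    show "subgroup (Rd 0) (add_monoid R)" by (rule G.R_graded.piece_subgroup)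
    show "a \<otimes>\<^bsub>R\<^esub> b \<in> Rd 0" if "a \<in> Rd 0" "b \<in> Rd 0" for a b using A.mult_degree[OF that] by simp
    show "\<exists>d\<in>Rd 0. d \<otimes>\<^bsub>R\<^esub> c = \<one>\<^bsub>R\<^esub>" if "c \<in> Rd 0" "c \<noteq> \<zero>\<^bsub>R\<^esub>" for c
      by (rule A.degree_zero_division[OF assms(1) that])
    show "N \<in> stable_subgroups M (carrier R)" by (rule G.homogeneous_stable[OF hom])
  qed
  moreover obtain a where "\<forall>x\<in>carrier M. \<forall>i<a. G.part i x \<in> N"
    using G.degrees_bounded_below[OF hom fgM] by blast
  ultimately show ?thesis
    by (intro G.length_eq_graded_length[OF hom A.degree_zero_image, where a = a]) auto
qed

theorem corollary4p2:
  fixes K :: "('k, 'c) ring_scheme" and R :: "('k, 'r, 'd) module_scheme"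
    and M :: "('r, 'm, 'e) module_scheme"
    and Rd :: "nat \<Rightarrow> 'r set" and Md :: "int \<Rightarrow> 'm set" and I :: "'r set" and p :: nat
  assumes "field K" and "has_characteristic K p" and "p > 0"
    and "nat_graded_algebra K R Rd" and "fin_gen_algebra K R"
    and "homogeneous_ideal R Rd I" and "finite_colength R I"
    and "int_graded_module R M Rd Md" and "fin_gen_module R M"
  shows "hilbert_kunz_multiplicity p R M I = frobenius_poincare p K R M Md I 0"
  unfolding hilbert_kunz_multiplicity_def frobenius_poincare_def
  by (simp add: length_eq_sum_of_graded_lengths[OF assms refl])

end
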